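(* Let $0<\alpha<n$, $0\leq\lambda<n$, $1<p<(n-\lambda)/\alpha$ and $\frac1q=\frac1p-\frac{\alpha}{n-\lambda}$. Let $T^\alpha$ be any of the operators $I^\alpha$, $M^\alpha$, $H^\alpha$, $\mathcal{H}^\alpha$. Then $T^\alpha$ is bounded from $V^{(\ast)}L^{p,\lambda}(\mathbb{R}^n)$ into $V^{(\ast)}L^{q,\lambda}(\mathbb{R}^n)$; that is, $T^\alpha f\in V^{(\ast)}L^{q,\lambda}(\mathbb{R}^n)$ for every $f\in V^{(\ast)}L^{p,\lambda}(\mathbb{R}^n)$, and $\|T^\alpha f\|_{q,\lambda}\leq C\|f\|_{p,\lambda}$ with $C$ independent of $f$.
   Context: For $x\in\mathbb{R}^n$, $r>0$, let $B(x,r)$ be the open ball. For $1\le p<\infty$, $0\le\lambda\le n$, the Morrey space $L^{p,\lambda}(\mathbb{R}^n)$ consists of all locally $p$-integrable $f$ on $\mathbb{R}^n$ with $\|f\|_{p,\lambda}:=\sup_{x\in\mathbb{R}^n,\,r>0}\left(\frac{1}{r^\lambda}\int_{B(x,r)}|f(y)|^p\,dy\right)^{1/p}<\infty$. The subspace $V^{(\ast)}L^{p,\lambda}(\mathbb{R}^n)$ consists of all $f\in L^{p,\lambda}(\mathbb{R}^n)$ with $$\lim_{N\to\infty}\ \sup_{x\in\mathbb{R}^n}\int_{B(x,1)}|f(y)|^p\,\chi_N(y)\,dy=0,\qquad \chi_N:=\chi_{\mathbb{R}^n\setminus B(0,N)},\ N\in\mathbb{N}.$$ Operators, for $0<\alpha<n$: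 - Riesz potential $I^\alpha f(x):=\int_{\mathbb{R}^n}\frac{f(y)}{|x-y|^{n-\alpha}}\,dy$; - fractional maximal operator $M^\alpha f(x):=\sup_{t>0}\frac{1}{|B(x,t)|^{1-\alpha/n}}\int_{B(x,t)}|f(y)|\,dy$; - Hardy type operators $H^\alpha f(x):=|x|^{\alpha-n}\int_{|y|<|x|}f(y)\,dy$ and $\mathcal{H}^\alpha f(x):=|x|^\alpha\int_{|y|>|x|}\frac{f(y)}{|y|^n}\,dy$. *)

theory Defs
  imports "HOL-Analysis.Analysis"
begin

text \<open>
  The space R^n is an arbitrary type of class \<open>euclidean_space\<close> with \<open>n = DIM('a)\<close>. Elements of the
  function spaces are Lebesgue measurable functions rather than classes modulo null sets.
\<close>

definition locally_p_integrable :: "real \<Rightarrow> ('a::euclidean_space \<Rightarrow> 'b::euclidean_space) \<Rightarrow> bool" where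
  "locally_p_integrable p f \<longleftrightarrow>
     f \<in> borel_measurable lebesgue \<and>
     (\<forall>K. compact K \<longrightarrow> set_integrable lebesgue K (\<lambda>y. norm (f y) powr p))"

text \<open>
  The norm takes values in the extended half-line. It is meaningful for locally \<open>p\<close>-integrable
  functions only, since a divergent Bochner integral has value 0.
\<close>

definition morrey_norm :: "real \<Rightarrow> real \<Rightarrow> ('a::euclidean_space \<Rightarrow> 'b::euclidean_space) \<Rightarrow> ennreal" where
  "morrey_norm p l f =
     (SUP x. SUP r\<in>{0<..}.
        ennreal ((1 / r powr l * (LINT y:ball x r|lebesgue. norm (f y) powr p)) powr (1 / p)))"

definition morrey_space :: "real \<Rightarrow> real \<Rightarrow> ('a::euclidean_space \<Rightarrow> 'b::euclidean_space) set" where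
  "morrey_space p l = {f. locally_p_integrable p f \<and> morrey_norm p l f < \<infinity>}"

definition vanishing_morrey_space ::
    "real \<Rightarrow> real \<Rightarrow> ('a::euclidean_space \<Rightarrow> 'b::euclidean_space) set" where
  "vanishing_morrey_space p l =
     {f \<in> morrey_space p l.
        (\<lambda>N::nat. SUP x. \<integral>\<^sup>+ y\<in>ball x 1. ennreal (norm (f y) powr p * indicator (- ball 0 (real N)) y) \<partial>lebesgue)
          \<longlonglongrightarrow> 0}"

text \<open>
  Each operator comes with a predicate saying when its defining formula makes sense at a point:
  absolute convergence of the integral, or finiteness of the supremum. Where this fails, the
  operator has the junk value 0.
\<close>

definition riesz_potential ::
    "real \<Rightarrow> ('a::euclidean_space \<Rightarrow> 'b::euclidean_space) \<Rightarrow> 'a \<Rightarrow> 'b" where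
  "riesz_potential \<alpha> f x =
     (LINT y|lebesgue. (1 / norm (x - y) powr (real DIM('a) - \<alpha>)) *\<^sub>R f y)"

definition riesz_potential_defined ::
    "real \<Rightarrow> ('a::euclidean_space \<Rightarrow> 'b::euclidean_space) \<Rightarrow> 'a \<Rightarrow> bool" where
  "riesz_potential_defined \<alpha> f x \<longleftrightarrow>
     integrable lebesgue (\<lambda>y. (1 / norm (x - y) powr (real DIM('a) - \<alpha>)) *\<^sub>R f y)"

definition ext_fractional_maximal ::
    "real \<Rightarrow> ('a::euclidean_space \<Rightarrow> 'b::euclidean_space) \<Rightarrow> 'a \<Rightarrow> ennreal" where
  "ext_fractional_maximal \<alpha> f x =
     (SUP t\<in>{0<..}.
        ennreal (1 / measure lebesgue (ball x t) powr (1 - \<alpha> / real DIM('a))) *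
        (\<integral>\<^sup>+ y\<in>ball x t. ennreal (norm (f y)) \<partial>lebesgue))"

definition fractional_maximal ::
    "real \<Rightarrow> ('a::euclidean_space \<Rightarrow> 'b::euclidean_space) \<Rightarrow> 'a \<Rightarrow> real" where
  "fractional_maximal \<alpha> f x = enn2real (ext_fractional_maximal \<alpha> f x)"

definition fractional_maximal_defined ::
    "real \<Rightarrow> ('a::euclidean_space \<Rightarrow> 'b::euclidean_space) \<Rightarrow> 'a \<Rightarrow> bool" where
  "fractional_maximal_defined \<alpha> f x \<longleftrightarrow> ext_fractional_maximal \<alpha> f x < \<infinity>"

definition hardy_inner ::
    "real \<Rightarrow> ('a::euclidean_space \<Rightarrow> 'b::euclidean_space) \<Rightarrow> 'a \<Rightarrow> 'b" where
  "hardy_inner \<alpha> f x =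
     norm x powr (\<alpha> - real DIM('a)) *\<^sub>R (LINT y:{y. norm y < norm x}|lebesgue. f y)"

definition hardy_inner_defined ::
    "real \<Rightarrow> ('a::euclidean_space \<Rightarrow> 'b::euclidean_space) \<Rightarrow> 'a \<Rightarrow> bool" where
  "hardy_inner_defined \<alpha> f x \<longleftrightarrow> set_integrable lebesgue {y. norm y < norm x} f"

definition hardy_outer ::
    "real \<Rightarrow> ('a::euclidean_space \<Rightarrow> 'b::euclidean_space) \<Rightarrow> 'a \<Rightarrow> 'b" where
  "hardy_outer \<alpha> f x =
     norm x powr \<alpha> *\<^sub>R (LINT y:{y. norm y > norm x}|lebesgue. (1 / norm y ^ DIM('a)) *\<^sub>R f y)"

definition hardy_outer_defined ::
    "real \<Rightarrow> ('a::euclidean_space \<Rightarrow> 'b::euclidean_space) \<Rightarrow> 'a \<Rightarrow> bool" where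
  "hardy_outer_defined \<alpha> f x \<longleftrightarrow>
     set_integrable lebesgue {y. norm y > norm x} (\<lambda>y. (1 / norm y ^ DIM('a)) *\<^sub>R f y)"

text \<open>
  Boundedness between vanishing Morrey spaces of an operator \<open>T\<close>, not necessarily linear. Here
  \<open>D f x\<close> says that \<open>T f x\<close> is well defined, which is required almost everywhere, so that the
  junk values do not matter.
\<close>

definition bounded_between_vanishing_morrey ::
    "real \<Rightarrow> real \<Rightarrow> real \<Rightarrow> (('a::euclidean_space \<Rightarrow> 'b::euclidean_space) \<Rightarrow> 'a \<Rightarrow> bool) \<Rightarrow>
     (('a \<Rightarrow> 'b) \<Rightarrow> 'a \<Rightarrow> 'c::euclidean_space) \<Rightarrow> bool" where
  "bounded_between_vanishing_morrey p q l D T \<longleftrightarrow>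
     (\<forall>f\<in>vanishing_morrey_space p l.
        (AE x in lebesgue. D f x) \<and> T f \<in> vanishing_morrey_space q l) \<and>
     (\<exists>C::real. \<forall>f\<in>vanishing_morrey_space p l.
        morrey_norm q l (T f) \<le> ennreal C * morrey_norm p l f)"

end

theory Submission
  imports Defs
begin

text \<open>
  Each of the four operators is dominated pointwise by the Riesz potential \<open>J\<close> of \<open>g = |f|\<close>, whose
  kernel is \<open>|x - y| powr (\<alpha> - n)\<close>. For Adams' inequality no maximal function is needed. By the Morrey
  bound, the part of \<open>J x\<close> coming from \<open>|x - y| \<ge> \<rho>\<close> is \<open>O(\<rho> powr (- (n - l) / q))\<close>. Given a level \<open>t\<close>,
  choose \<open>\<rho>\<close> such that this is at most \<open>t / 3\<close>, and truncate \<open>g\<close> at a height \<open>s\<close> proportional to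
  \<open>t powr (q / p)\<close> such that the near part of the truncation is at most \<open>t / 3\<close>. Then the \<open>L\<^sup>1\<close> bound for
  the near part gives \<open>s |{J > t}| \<le> \<integral> g\<close> over \<open>{g > s}\<close>, and integrating in \<open>t\<close> bounds \<open>\<integral> J powr q\<close> by a
  multiple of \<open>\<integral> g powr p\<close>.

  On \<open>ball z r\<close> apply this to the restriction of \<open>g\<close> to \<open>ball z (r + s)\<close>; the rest of \<open>J\<close> is controlled by
  the far estimate. Taking \<open>s = r\<close> gives the Morrey bound. Taking \<open>r = 1\<close> and \<open>s\<close> large makes the far
  part small uniformly in \<open>z\<close>, while the near part is small for distant \<open>z\<close> since \<open>ball z (1 + s)\<close> is
  covered by a fixed number of unit balls.
\<close>

section \<open>Kernel estimates\<close>

lemma ball_borel [measurable]: "ball x r \<in> sets (borel :: 'a::euclidean_space measure)"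
  by simp

lemma nn_integral_powr_from_0:
  fixes a c :: real
  assumes "c > 0" "a \<ge> 0"
  shows "(\<integral>\<^sup>+t. ennreal (t powr (c - 1)) * indicator {0..a} t \<partial>lborel) = ennreal (a powr c / c)"
proof -
  have "((\<lambda>x. x powr (c - 1)) has_integral (a powr (c - 1 + 1) / (c - 1 + 1))) {0..a}"
    by (rule has_integral_powr_from_0) (use assms in auto)
  then have "integral\<^sup>N lborel (\<lambda>x. indicator {0..a} x * x powr (c - 1)) = a powr c / c"
    by (intro nn_integral_has_integral_lebesgue) auto
  then show ?thesis
    by (simp add: ennreal_mult' ennreal_indicator mult.commute)
qed

lemma nn_integral_powr_to_inf:
  fixes a c :: real
  assumes "c > 0" "a > 0"
  shows "(\<integral>\<^sup>+t. ennreal (t powr (- c - 1)) * indicator {a..} t \<partial>lborel) = ennreal (a powr (- c) / c)"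
proof -
  have "((\<lambda>x. x powr (- c - 1)) has_integral - (a powr (- c - 1 + 1)) / (- c - 1 + 1)) {a..}"
    by (rule has_integral_powr_to_inf) (use assms in auto)
  then have "integral\<^sup>N lborel (\<lambda>x. indicator {a..} x * x powr (- c - 1))
      = ennreal (- (a powr (- c - 1 + 1)) / (- c - 1 + 1))"
    by (intro nn_integral_has_integral_lebesgue) auto
  then show ?thesis
    by (simp add: ennreal_mult' ennreal_indicator mult.commute)
qed

text \<open>The kernel is recovered by integrating minus its derivative over the radii beyond
  \<open>d\<close>. At \<open>d = 0\<close> the left side is \<open>1 / 0 = 0\<close> while the
  right side diverges, hence only an inequality.\<close>

lemma inverse_powr_le_layers:
  fixes d \<gamma> :: real
  assumes "\<gamma> > 0" "d \<ge> 0"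
  shows "ennreal (1 / d powr \<gamma>) \<le> (\<integral>\<^sup>+r. ennreal (\<gamma> * r powr (- \<gamma> - 1)) * indicator {d<..} r \<partial>lborel)"
proof (cases "d = 0")
  case False
  then have d: "d > 0" using assms by simp
  have "(\<integral>\<^sup>+r. ennreal (\<gamma> * r powr (- \<gamma> - 1)) * indicator {d<..} r \<partial>lborel)
      = (\<integral>\<^sup>+r. ennreal \<gamma> * (ennreal (r powr (- \<gamma> - 1)) * indicator {d..} r) \<partial>lborel)"
    using AE_lborel_singleton[of d] assms
    by (intro nn_integral_cong_AE) (auto simp: ennreal_mult' indicator_def)
  also have "\<dots> = ennreal \<gamma> * ennreal (d powr (- \<gamma>) / \<gamma>)"
    using nn_integral_powr_to_inf[OF assms(1) d] by (subst nn_integral_cmult) auto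
  also have "\<dots> = ennreal (1 / d powr \<gamma>)"
    using assms by (simp flip: ennreal_mult' add: powr_minus field_simps)
  finally show ?thesis by simp
qed auto

text \<open>The values are extended, so that no convergence question arises before the bounds are
  known. The exponent \<open>\<gamma>\<close> stands for \<open>n - \<alpha>\<close>. On the
  diagonal the kernel has value 0 instead of infinity, which affects a null set only.\<close>

definition riesz_nn :: "real \<Rightarrow> ('a::euclidean_space \<Rightarrow> ennreal) \<Rightarrow> 'a \<Rightarrow> ennreal" where
  "riesz_nn \<gamma> h x = (\<integral>\<^sup>+y. ennreal (1 / norm (x - y) powr \<gamma>) * h y \<partial>lborel)"

lemma borel_measurable_riesz_nn [measurable]:
  assumes [measurable]: "h \<in> borel_measurable borel"
  shows "riesz_nn \<gamma> h \<in> borel_measurable borel"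
proof -
  have "(\<lambda>x. \<integral>\<^sup>+y. ennreal (1 / norm (x - y) powr \<gamma>) * h y \<partial>lborel) \<in> borel_measurable lborel"
    by (rule lborel.borel_measurable_nn_integral) measurable
  then show ?thesis unfolding riesz_nn_def[abs_def] by simp
qed

lemma riesz_nn_mono: "(\<And>y. h y \<le> h' y) \<Longrightarrow> riesz_nn \<gamma> h x \<le> riesz_nn \<gamma> h' x"
  unfolding riesz_nn_def by (intro nn_integral_mono mult_left_mono) auto

lemma riesz_nn_add:
  assumes [measurable]: "h \<in> borel_measurable borel" "h' \<in> borel_measurable borel"
  shows "riesz_nn \<gamma> (\<lambda>y. h y + h' y) x = riesz_nn \<gamma> h x + riesz_nn \<gamma> h' x"
  unfolding riesz_nn_def by (subst nn_integral_add[symmetric]) (auto simp: distrib_left)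

text \<open>The layer formula for the kernel and Tonelli reduce bounds on the potential to bounds on
  integrals over balls centred at \<open>x\<close>.\<close>

lemma riesz_nn_layers:
  assumes [measurable]: "h \<in> borel_measurable borel" and "\<gamma> > 0"
  shows "riesz_nn \<gamma> h x \<le>
    (\<integral>\<^sup>+r. ennreal (\<gamma> * r powr (- \<gamma> - 1)) * (\<integral>\<^sup>+y. h y * indicator (ball x r) y \<partial>lborel) \<partial>lborel)"
proof -
  have "riesz_nn \<gamma> h x \<le> (\<integral>\<^sup>+y. (\<integral>\<^sup>+r. ennreal (\<gamma> * r powr (- \<gamma> - 1)) * indicator {norm (x - y)<..} r \<partial>lborel) * h y \<partial>lborel)"
    unfolding riesz_nn_def by (intro nn_integral_mono mult_right_mono inverse_powr_le_layers) (use assms in auto)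
  also have "\<dots> = (\<integral>\<^sup>+y. (\<integral>\<^sup>+r. ennreal (\<gamma> * r powr (- \<gamma> - 1)) * (if norm (x - y) < r then h y else 0) \<partial>lborel) \<partial>lborel)"
    by (subst nn_integral_multc[symmetric])
       (auto intro!: nn_integral_cong simp: indicator_def)
  also have "\<dots> = (\<integral>\<^sup>+r. (\<integral>\<^sup>+y. ennreal (\<gamma> * r powr (- \<gamma> - 1)) * (if norm (x - y) < r then h y else 0) \<partial>lborel) \<partial>lborel)"
    by (rule lborel_pair.Fubini') measurable
  also have "\<dots> = (\<integral>\<^sup>+r. ennreal (\<gamma> * r powr (- \<gamma> - 1)) * (\<integral>\<^sup>+y. h y * indicator (ball x r) y \<partial>lborel) \<partial>lborel)"
    by (subst nn_integral_cmult[symmetric])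
       (auto intro!: nn_integral_cong simp: indicator_def dist_norm)
  finally show ?thesis .
qed

text \<open>Only layers with \<open>r > \<rho>\<close> meet the complement of
  \<open>ball x \<rho>\<close>. On these the growth hypothesis leaves
  \<open>r powr (\<beta> - \<gamma> - 1)\<close>, which is integrable at infinity because
  \<open>\<beta> < \<gamma>\<close>.\<close>

lemma riesz_nn_far:
  assumes [measurable]: "h \<in> borel_measurable borel"
    and pos: "\<gamma> > 0" "\<rho> > 0" "A \<ge> 0" and "\<beta> < \<gamma>"
    and grow: "\<And>r. r > \<rho> \<Longrightarrow> (\<integral>\<^sup>+y. h y * indicator (ball x r) y \<partial>lborel) \<le> ennreal (A * r powr \<beta>)"
  shows "riesz_nn \<gamma> (\<lambda>y. h y * indicator (- ball x \<rho>) y) x \<le> ennreal (\<gamma> / (\<gamma> - \<beta>) * A * \<rho> powr (\<beta> - \<gamma>))"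
proof -
  have "riesz_nn \<gamma> (\<lambda>y. h y * indicator (- ball x \<rho>) y) x \<le>
     (\<integral>\<^sup>+r. ennreal (\<gamma> * r powr (- \<gamma> - 1)) * (\<integral>\<^sup>+y. (h y * indicator (- ball x \<rho>) y) * indicator (ball x r) y \<partial>lborel) \<partial>lborel)"
    by (rule riesz_nn_layers) (use pos in auto)
  also have "\<dots> \<le> (\<integral>\<^sup>+r. ennreal (\<gamma> * A) * (ennreal (r powr (- (\<gamma> - \<beta>) - 1)) * indicator {\<rho>..} r) \<partial>lborel)"
  proof (rule nn_integral_mono)
    fix r :: real
    show "ennreal (\<gamma> * r powr (- \<gamma> - 1)) * (\<integral>\<^sup>+y. (h y * indicator (- ball x \<rho>) y) * indicator (ball x r) y \<partial>lborel)
      \<le> ennreal (\<gamma> * A) * (ennreal (r powr (- (\<gamma> - \<beta>) - 1)) * indicator {\<rho>..} r)"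
    proof (cases "r > \<rho>")
      case True
      have "(\<integral>\<^sup>+y. (h y * indicator (- ball x \<rho>) y) * indicator (ball x r) y \<partial>lborel)
          \<le> (\<integral>\<^sup>+y. h y * indicator (ball x r) y \<partial>lborel)"
        by (intro nn_integral_mono) (auto simp: indicator_def)
      also have "\<dots> \<le> ennreal (A * r powr \<beta>)" by (rule grow[OF True])
      finally have "ennreal (\<gamma> * r powr (- \<gamma> - 1)) * (\<integral>\<^sup>+y. (h y * indicator (- ball x \<rho>) y) * indicator (ball x r) y \<partial>lborel)
         \<le> ennreal (\<gamma> * r powr (- \<gamma> - 1)) * ennreal (A * r powr \<beta>)"
        by (rule mult_left_mono) auto
      also have "\<dots> = ennreal (\<gamma> * A * r powr (- (\<gamma> - \<beta>) - 1))"
      proof -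
        have "r powr (- \<gamma> - 1) * r powr \<beta> = r powr (- (\<gamma> - \<beta>) - 1)"
          by (simp flip: powr_add add: algebra_simps)
        then show ?thesis
          using pos by (simp flip: ennreal_mult' add: mult_ac)
      qed
      finally show ?thesis using True pos by (simp add: ennreal_mult')
    next
      case False
      then have "(\<lambda>y. (h y * indicator (- ball x \<rho>) y) * indicator (ball x r) y) = (\<lambda>_. 0)"
        by (auto simp: indicator_def fun_eq_iff)
      then show ?thesis by simp
    qed
  qed
  also have "\<dots> = ennreal (\<gamma> * A) * ennreal (\<rho> powr (- (\<gamma> - \<beta>)) / (\<gamma> - \<beta>))"
    using nn_integral_powr_to_inf[of "\<gamma> - \<beta>" \<rho>] assms by (subst nn_integral_cmult) auto
  also have "\<dots> = ennreal (\<gamma> / (\<gamma> - \<beta>) * A * \<rho> powr (\<beta> - \<gamma>))"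
    using assms by (simp flip: ennreal_mult' add: field_simps)
  finally show ?thesis .
qed

text \<open>The layer of radius \<open>r\<close> carries the volume of the smaller of the balls of
  radius \<open>r\<close> and \<open>\<rho>\<close>. The layers below \<open>\<rho>\<close> converge
  at 0 because \<open>\<gamma> < n\<close> and give the summand
  \<open>\<gamma> / (n - \<gamma>)\<close>; those above \<open>\<rho>\<close> give the summand
  1.\<close>

lemma riesz_nn_near:
  assumes pos: "\<gamma> > 0" "\<rho> > 0" and "\<gamma> < real DIM('a::euclidean_space)"
  shows "riesz_nn \<gamma> (indicator (ball x \<rho>)) (x::'a)
     \<le> ennreal (unit_ball_vol (real DIM('a)) * (\<gamma> / (real DIM('a) - \<gamma>) + 1) * \<rho> powr (real DIM('a) - \<gamma>))"
proof -
  let ?n = "real DIM('a)" and ?w = "unit_ball_vol (real DIM('a))"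
  have w: "?w \<ge> 0" by simp
  have "riesz_nn \<gamma> (indicator (ball x \<rho>)) x \<le>
     (\<integral>\<^sup>+r. ennreal (\<gamma> * r powr (- \<gamma> - 1)) * (\<integral>\<^sup>+y. indicator (ball x \<rho>) y * indicator (ball x r) y \<partial>lborel) \<partial>lborel)"
    using pos by (intro riesz_nn_layers borel_measurable_indicator) auto
  also have "\<dots> \<le> (\<integral>\<^sup>+r. ennreal (\<gamma> * ?w) * (ennreal (r powr ((?n - \<gamma>) - 1)) * indicator {0..\<rho>} r)
       + ennreal (\<gamma> * ?w * \<rho> powr ?n) * (ennreal (r powr (- \<gamma> - 1)) * indicator {\<rho>..} r) \<partial>lborel)"
  proof (rule nn_integral_mono)
    fix r :: real
    have vol: "emeasure lborel (ball x s) = ennreal (?w * s powr ?n)" if "s > 0" for s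
      using that by (simp add: emeasure_ball powr_realpow)
    show "ennreal (\<gamma> * r powr (- \<gamma> - 1)) * (\<integral>\<^sup>+y. indicator (ball x \<rho>) y * indicator (ball x r) y \<partial>lborel)
      \<le> ennreal (\<gamma> * ?w) * (ennreal (r powr ((?n - \<gamma>) - 1)) * indicator {0..\<rho>} r)
       + ennreal (\<gamma> * ?w * \<rho> powr ?n) * (ennreal (r powr (- \<gamma> - 1)) * indicator {\<rho>..} r)"
    proof -
      consider "r \<le> 0" | "0 < r" "r \<le> \<rho>" | "\<rho> < r" by linarith
      then show ?thesis
      proof cases
        case 1
        then have "(\<lambda>y. indicator (ball x \<rho>) y * indicator (ball x r) y) = (\<lambda>_. 0 :: ennreal)"
          by (auto simp: fun_eq_iff ball_empty)
        then show ?thesis by simp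
      next
        case 2
        have "(\<integral>\<^sup>+y. indicator (ball x \<rho>) y * indicator (ball x r) y \<partial>lborel) \<le> (\<integral>\<^sup>+y. indicator (ball x r) y \<partial>lborel)"
          by (intro nn_integral_mono) (auto simp: indicator_def)
        also have "\<dots> = ennreal (?w * r powr ?n)" using 2 vol by simp
        finally have "ennreal (\<gamma> * r powr (- \<gamma> - 1)) * (\<integral>\<^sup>+y. indicator (ball x \<rho>) y * indicator (ball x r) y \<partial>lborel)
            \<le> ennreal (\<gamma> * r powr (- \<gamma> - 1)) * ennreal (?w * r powr ?n)"
          by (rule mult_left_mono) auto
        also have "\<dots> = ennreal (\<gamma> * ?w * r powr ((?n - \<gamma>) - 1))"
        proof -
          have "r powr (- \<gamma> - 1) * r powr ?n = r powr ((?n - \<gamma>) - 1)"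
            by (simp flip: powr_add add: algebra_simps)
          then show ?thesis
            using pos by (simp flip: ennreal_mult' add: mult_ac)
        qed
        also have "\<dots> = ennreal (\<gamma> * ?w) * (ennreal (r powr ((?n - \<gamma>) - 1)) * indicator {0..\<rho>} r)"
          using 2 pos w by (simp add: ennreal_mult')
        finally show ?thesis by (rule order_trans) simp
      next
        case 3
        have "(\<integral>\<^sup>+y. indicator (ball x \<rho>) y * indicator (ball x r) y \<partial>lborel) \<le> (\<integral>\<^sup>+y. indicator (ball x \<rho>) y \<partial>lborel)"
          by (intro nn_integral_mono) (auto simp: indicator_def)
        also have "\<dots> = ennreal (?w * \<rho> powr ?n)" using pos vol by simp
        finally have "ennreal (\<gamma> * r powr (- \<gamma> - 1)) * (\<integral>\<^sup>+y. indicator (ball x \<rho>) y * indicator (ball x r) y \<partial>lborel)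
            \<le> ennreal (\<gamma> * r powr (- \<gamma> - 1)) * ennreal (?w * \<rho> powr ?n)"
          by (rule mult_left_mono) auto
        also have "\<dots> = ennreal (\<gamma> * ?w * \<rho> powr ?n) * (ennreal (r powr (- \<gamma> - 1)) * indicator {\<rho>..} r)"
          using 3 pos w by (simp flip: ennreal_mult' add: mult_ac)
        finally show ?thesis by (rule order_trans) simp
      qed
    qed
  qed
  also have "\<dots> = ennreal (\<gamma> * ?w) * ennreal (\<rho> powr (?n - \<gamma>) / (?n - \<gamma>))
      + ennreal (\<gamma> * ?w * \<rho> powr ?n) * ennreal (\<rho> powr (- \<gamma>) / \<gamma>)"
    using nn_integral_powr_from_0[of "?n - \<gamma>" \<rho>] nn_integral_powr_to_inf[of \<gamma> \<rho>] assms
    by (simp add: nn_integral_add nn_integral_cmult)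
  also have "\<dots> = ennreal (?w * (\<gamma> / (?n - \<gamma>) + 1) * \<rho> powr (?n - \<gamma>))"
  proof -
    have "\<rho> powr ?n * \<rho> powr (- \<gamma>) = \<rho> powr (?n - \<gamma>)" by (simp flip: powr_add)
    then have "\<gamma> * ?w * \<rho> powr ?n * (\<rho> powr (- \<gamma>) / \<gamma>) = ?w * \<rho> powr (?n - \<gamma>)"
      using pos by (simp add: field_simps)
    then have "\<gamma> * ?w * (\<rho> powr (?n - \<gamma>) / (?n - \<gamma>)) + \<gamma> * ?w * \<rho> powr ?n * (\<rho> powr (- \<gamma>) / \<gamma>)
       = ?w * (\<gamma> / (?n - \<gamma>) + 1) * \<rho> powr (?n - \<gamma>)"
      by (simp add: algebra_simps)
    then show ?thesis
      using assms w by (simp flip: ennreal_mult' ennreal_plus)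
  qed
  finally show ?thesis .
qed

text \<open>Young's inequality in the crude form \<open>g \<le> c + c powr (1 - p) * g powr p\<close>, with \<open>c\<close> chosen so
  that the two terms balance, replaces Hoelder's inequality.\<close>
lemma ball_integral_le_of_powr:
  fixes g :: "'a::euclidean_space \<Rightarrow> real"
  assumes [measurable]: "g \<in> borel_measurable borel" and g0: "\<And>y. g y \<ge> 0"
    and pos: "r > 0" "K > 0" "1 < p"
    and grow: "(\<integral>\<^sup>+y. ennreal (g y powr p) * indicator (ball x r) y \<partial>lborel) \<le> ennreal (K * r powr l)"
  shows "(\<integral>\<^sup>+y. ennreal (g y) * indicator (ball x r) y \<partial>lborel)
     \<le> ennreal ((unit_ball_vol (real DIM('a)) + 1) * K powr (1 / p) * r powr (real DIM('a) - (real DIM('a) - l) / p))"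
proof -
  let ?n = "real DIM('a)" and ?w = "unit_ball_vol (real DIM('a))"
  define c where "c = K powr (1 / p) * r powr ((l - ?n) / p)"
  have c: "c > 0" using pos by (simp add: c_def)
  have w: "?w \<ge> 0" by simp
  have "g y \<le> c + c powr (1 - p) * g y powr p" for y
  proof (cases "g y \<le> c")
    case True
    then show ?thesis by (simp add: add_increasing2)
  next
    case False
    then have gy: "g y > 0" using c by simp
    have "g y powr (1 - p) \<le> c powr (1 - p)"
      by (rule powr_mono2') (use False c pos in auto)
    then have "g y powr (1 - p) * g y powr p \<le> c powr (1 - p) * g y powr p"
      by (rule mult_right_mono) simp
    moreover have "g y powr (1 - p) * g y powr p = g y" using gy by (simp flip: powr_add)
    ultimately show ?thesis using c by linarith
  qed
  then have "(\<integral>\<^sup>+y. ennreal (g y) * indicator (ball x r) y \<partial>lborel)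
    \<le> (\<integral>\<^sup>+y. ennreal (c + c powr (1 - p) * g y powr p) * indicator (ball x r) y \<partial>lborel)"
    by (intro nn_integral_mono mult_right_mono ennreal_leI) auto
  also have "\<dots> = (\<integral>\<^sup>+y. ennreal c * indicator (ball x r) y + ennreal (c powr (1 - p)) * (ennreal (g y powr p) * indicator (ball x r) y) \<partial>lborel)"
    using c by (intro nn_integral_cong) (auto simp: ennreal_mult' indicator_def)
  also have "\<dots> = ennreal c * emeasure lborel (ball x r) + ennreal (c powr (1 - p)) * (\<integral>\<^sup>+y. ennreal (g y powr p) * indicator (ball x r) y \<partial>lborel)"
    by (simp add: nn_integral_add nn_integral_cmult)
  also have "\<dots> \<le> ennreal c * ennreal (?w * r powr ?n) + ennreal (c powr (1 - p)) * ennreal (K * r powr l)"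
    using pos by (intro add_mono mult_left_mono grow) (auto simp: emeasure_ball powr_realpow)
  also have "\<dots> = ennreal (c * (?w * r powr ?n) + c powr (1 - p) * (K * r powr l))"
    using c pos w by (simp flip: ennreal_mult' ennreal_plus)
  also have "c * (?w * r powr ?n) + c powr (1 - p) * (K * r powr l)
      = (?w + 1) * K powr (1 / p) * r powr (?n - (?n - l) / p)"
  proof -
    have 1: "c * r powr ?n = K powr (1 / p) * r powr (?n - (?n - l) / p)"
    proof -
      have e: "(l - ?n) / p + ?n = ?n - (?n - l) / p" by (simp add: diff_divide_distrib)
      show ?thesis unfolding c_def mult.assoc powr_add[symmetric] e ..
    qed
    have 2: "c powr (1 - p) * (K * r powr l) = K powr (1 / p) * r powr (?n - (?n - l) / p)"
    proof -
      have "c powr (1 - p) * (K * r powr l)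
          = (K powr (1 / p * (1 - p)) * K) * (r powr ((l - ?n) / p * (1 - p)) * r powr l)"
        by (simp add: c_def powr_mult powr_powr mult_ac)
      moreover have "K powr (1 / p * (1 - p)) * K = K powr (1 / p)"
      proof -
        have "1 / p * (1 - p) + 1 = 1 / p" using pos by (simp add: field_simps)
        then show ?thesis using pos powr_add[of K "1 / p * (1 - p)" 1] by simp
      qed
      moreover have "r powr ((l - ?n) / p * (1 - p)) * r powr l = r powr (?n - (?n - l) / p)"
      proof -
        have "(l - ?n) / p * (1 - p) + l = ?n - (?n - l) / p" using pos by (simp add: field_simps)
        then show ?thesis by (simp flip: powr_add)
      qed
      ultimately show ?thesis by (simp only:)
    qed
    have "c * (?w * r powr ?n) = ?w * (c * r powr ?n)" by simp
    then show ?thesis unfolding 1 2 by (simp add: algebra_simps)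
  qed
  finally show ?thesis .
qed

section \<open>The strong type inequality\<close>

text \<open>The value \<open>top\<close> is singled out because \<open>enn2real\<close> sends it to
  0. A finite power thus implies a finite base, from which finiteness of the potential is later
  deduced.\<close>

definition ennpow :: "ennreal \<Rightarrow> real \<Rightarrow> ennreal" where
  "ennpow u q = (if u = top then top else ennreal (enn2real u powr q))"

lemma ennpow_ennreal [simp]: "a \<ge> 0 \<Longrightarrow> ennpow (ennreal a) q = ennreal (a powr q)"
  by (simp add: ennpow_def)

lemma ennpow_top [simp]: "ennpow top q = top"
  by (simp add: ennpow_def)

lemma borel_measurable_ennpow [measurable]:
  assumes [measurable]: "f \<in> borel_measurable M"
  shows "(\<lambda>x. ennpow (f x) q) \<in> borel_measurable M"
  unfolding ennpow_def by measurable

lemma ennpow_le_layers: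
  assumes "q > 0"
  shows "ennpow u q \<le> (\<integral>\<^sup>+t. ennreal (q * t powr (q - 1)) * indicator {t. 0 < t \<and> ennreal t < u} t \<partial>lborel)"
    (is "_ \<le> ?R u")
proof -
  have fin: "ennreal (a powr q) = ?R (ennreal a)" if "a \<ge> 0" for a
  proof -
    have "?R (ennreal a) = (\<integral>\<^sup>+t. ennreal q * (ennreal (t powr (q - 1)) * indicator {0..a} t) \<partial>lborel)"
      using AE_lborel_singleton[of a] assms that
      by (intro nn_integral_cong_AE) (auto simp: ennreal_mult' indicator_def ennreal_less_iff)
    also have "\<dots> = ennreal q * ennreal (a powr q / q)"
      using nn_integral_powr_from_0[of q a] assms that by (subst nn_integral_cmult) auto
    finally show ?thesis using assms by (simp flip: ennreal_mult')
  qed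
  show ?thesis
  proof (cases u)
    case (real a)
    then show ?thesis using fin by simp
  next
    case top
    \<comment> \<open>For infinite \<open>u\<close>, monotonicity puts every \<open>a powr q\<close>
      below the right side, and these numbers exhaust the nonnegative reals.\<close>
    have *: "ennreal (a powr q) \<le> ?R top" if "a \<ge> 0" for a
      unfolding fin[OF that] by (intro nn_integral_mono mult_left_mono) (auto simp: indicator_def)
    have large: "ennreal b \<le> ?R top" if "b \<ge> 0" for b
    proof -
      have "(b powr (1 / q)) powr q = b" using that assms by (simp add: powr_powr)
      then show ?thesis using *[of "b powr (1 / q)"] by (simp only: powr_ge_zero)
    qed
    have "?R top = top"
    proof (cases "?R top")
      case (real b)
      then have "ennreal (b + 1) \<le> ennreal b" using large[of "b + 1"] by (simp only:)
      then show ?thesis using real by simp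
    qed
    then show ?thesis using top by simp
  qed
qed

text \<open>Near \<open>x\<close>, values of \<open>g\<close> up to \<open>s = t / (3 * N)\<close>
  contribute at most \<open>s * N = t / 3\<close>, and the far part contributes at most
  \<open>t / 3\<close>. A potential above \<open>t\<close> therefore forces the near potential of
  the remaining values to reach \<open>t / 3\<close>, and Chebyshev's inequality applies.\<close>

lemma level_set_estimate:
  fixes g :: "'a::euclidean_space \<Rightarrow> real"
  assumes [measurable]: "g \<in> borel_measurable borel"
    and pos: "t > 0" "N > 0"
    and near: "\<And>x::'a. riesz_nn \<gamma> (indicator (ball x \<rho>)) x \<le> ennreal N"
    and far: "\<And>x. riesz_nn \<gamma> (\<lambda>y. ennreal (g y) * indicator (- ball x \<rho>) y) x \<le> ennreal (t / 3)"
  shows "ennreal (t / (3 * N)) * emeasure lborel {x. ennreal t < riesz_nn \<gamma> (\<lambda>y. ennreal (g y)) x}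
     \<le> (\<integral>\<^sup>+y. ennreal (g y) * indicator {y. t / (3 * N) < g y} y \<partial>lborel)"
proof -
  define s where "s = t / (3 * N)"
  have s: "s > 0" using pos by (simp add: s_def)
  define G where "G y = ennreal (g y) * indicator {y. s < g y} y" for y
  have [measurable]: "G \<in> borel_measurable borel" unfolding G_def by measurable
  \<comment> \<open>This is the near potential of \<open>G\<close>. The condition
    \<open>dist x y < \<rho>\<close> replaces the indicator of a ball because it is visibly
    measurable in the pair and symmetric, as needed for exchanging the integrals.\<close>
  define F where "F x = (\<integral>\<^sup>+y. ennreal (1 / norm (x - y) powr \<gamma>) * (G y * (if dist x y < \<rho> then 1 else 0)) \<partial>lborel)" for x
  have [measurable]: "F \<in> borel_measurable borel"
  proof -
    have "F \<in> borel_measurable lborel"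
      unfolding F_def[abs_def] by (rule lborel.borel_measurable_nn_integral) measurable
    then show ?thesis by simp
  qed
  have bound: "riesz_nn \<gamma> (\<lambda>y. ennreal (g y)) x \<le> F x + ennreal (2 * t / 3)" for x
  proof -
    have "riesz_nn \<gamma> (\<lambda>y. ennreal (g y)) x
       \<le> riesz_nn \<gamma> (\<lambda>y. G y * indicator (ball x \<rho>) y + (ennreal s * indicator (ball x \<rho>) y
            + ennreal (g y) * indicator (- ball x \<rho>) y)) x"
      by (intro riesz_nn_mono) (auto simp: G_def indicator_def ennreal_leI)
    also have "\<dots> = riesz_nn \<gamma> (\<lambda>y. G y * indicator (ball x \<rho>) y) x
       + (riesz_nn \<gamma> (\<lambda>y. ennreal s * indicator (ball x \<rho>) y) x
        + riesz_nn \<gamma> (\<lambda>y. ennreal (g y) * indicator (- ball x \<rho>) y) x)"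
      by (simp add: riesz_nn_add)
    also have "riesz_nn \<gamma> (\<lambda>y. G y * indicator (ball x \<rho>) y) x = F x"
      unfolding riesz_nn_def F_def by (intro nn_integral_cong) (auto simp: indicator_def)
    also have "riesz_nn \<gamma> (\<lambda>y. ennreal s * indicator (ball x \<rho>) y) x
        = ennreal s * riesz_nn \<gamma> (indicator (ball x \<rho>)) x"
      unfolding riesz_nn_def by (subst nn_integral_cmult[symmetric]) (auto simp: mult_ac)
    also have "F x + (ennreal s * riesz_nn \<gamma> (indicator (ball x \<rho>)) x
        + riesz_nn \<gamma> (\<lambda>y. ennreal (g y) * indicator (- ball x \<rho>) y) x)
       \<le> F x + (ennreal s * ennreal N + ennreal (t / 3))"
      by (intro add_mono mult_left_mono near far) auto
    also have "ennreal s * ennreal N + ennreal (t / 3) = ennreal (2 * t / 3)"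
      using pos s by (simp flip: ennreal_mult' ennreal_plus add: s_def)
    finally show ?thesis .
  qed
  have sub: "{x. ennreal t < riesz_nn \<gamma> (\<lambda>y. ennreal (g y)) x} \<subseteq> {x. ennreal (t / 3) \<le> F x}"
  proof (intro subsetI CollectI, rule ccontr)
    fix x assume x: "x \<in> {x. ennreal t < riesz_nn \<gamma> (\<lambda>y. ennreal (g y)) x}" and "\<not> ennreal (t / 3) \<le> F x"
    then have "F x + ennreal (2 * t / 3) \<le> ennreal (t / 3) + ennreal (2 * t / 3)"
      by (intro add_right_mono) simp
    also have "\<dots> = ennreal t" using pos by (simp flip: ennreal_plus)
    finally show False using bound[of x] x by simp
  qed
  \<comment> \<open>After the exchange, the symmetry of the kernel turns the inner integral into the
    near kernel mass around \<open>y\<close>, which is at most \<open>N\<close>.\<close>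
  have "(\<integral>\<^sup>+x. F x \<partial>lborel) = (\<integral>\<^sup>+y. (\<integral>\<^sup>+x. ennreal (1 / norm (x - y) powr \<gamma>) * (G y * (if dist x y < \<rho> then 1 else 0)) \<partial>lborel) \<partial>lborel)"
    unfolding F_def by (rule lborel_pair.Fubini') measurable
  also have "\<dots> = (\<integral>\<^sup>+y. G y * riesz_nn \<gamma> (indicator (ball y \<rho>)) y \<partial>lborel)"
    unfolding riesz_nn_def
    by (subst nn_integral_cmult[symmetric])
       (auto intro!: nn_integral_cong simp: indicator_def norm_minus_commute dist_commute mult_ac)
  also have "\<dots> \<le> (\<integral>\<^sup>+y. G y * ennreal N \<partial>lborel)"
    by (intro nn_integral_mono mult_left_mono near) auto
  also have "\<dots> = (\<integral>\<^sup>+y. G y \<partial>lborel) * ennreal N"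
    by (rule nn_integral_multc) measurable
  finally have FN: "(\<integral>\<^sup>+x. F x \<partial>lborel) \<le> (\<integral>\<^sup>+y. G y \<partial>lborel) * ennreal N" .
  have "ennreal (t / 3) * emeasure lborel {x. ennreal (t / 3) \<le> F x}
     = (\<integral>\<^sup>+x. ennreal (t / 3) * indicator {x. ennreal (t / 3) \<le> F x} x \<partial>lborel)"
    by (simp add: nn_integral_cmult)
  also have "\<dots> \<le> (\<integral>\<^sup>+x. F x \<partial>lborel)"
    by (intro nn_integral_mono) (auto simp: indicator_def)
  finally have M: "ennreal (t / 3) * emeasure lborel {x. ennreal (t / 3) \<le> F x} \<le> (\<integral>\<^sup>+x. F x \<partial>lborel)" .
  have "ennreal s * emeasure lborel {x. ennreal t < riesz_nn \<gamma> (\<lambda>y. ennreal (g y)) x}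
      \<le> ennreal s * emeasure lborel {x. ennreal (t / 3) \<le> F x}"
    by (intro mult_left_mono emeasure_mono sub) auto
  also have "\<dots> = ennreal (1 / N) * (ennreal (t / 3) * emeasure lborel {x. ennreal (t / 3) \<le> F x})"
    using pos by (simp add: mult.assoc[symmetric] s_def flip: ennreal_mult') (simp add: mult.commute)
  also have "\<dots> \<le> ennreal (1 / N) * ((\<integral>\<^sup>+y. G y \<partial>lborel) * ennreal N)"
    using M FN by (intro mult_left_mono) auto
  also have "\<dots> = (ennreal (1 / N) * ennreal N) * (\<integral>\<^sup>+y. G y \<partial>lborel)"
    by (simp add: mult_ac)
  also have "ennreal (1 / N) * ennreal N = 1"
    using pos by (simp flip: ennreal_mult')
  finally show ?thesis unfolding s_def G_def by simp
qed

text \<open>Marcinkiewicz interpolation against \<open>L\<^sup>\<infinity>\<close>, with a truncation height for \<open>g\<close> depending on the level \<open>t\<close>.\<close>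
lemma strong_type_of_level_sets:
  fixes g :: "'a::euclidean_space \<Rightarrow> real" and J :: "'a \<Rightarrow> ennreal"
  assumes [measurable]: "g \<in> borel_measurable borel" "J \<in> borel_measurable borel" and g0: "\<And>y. g y \<ge> 0"
    and pos: "D > 0" "q > 0" "p > 1"
    and level: "\<And>t. t > 0 \<Longrightarrow> ennreal (D * t powr (q / p)) * emeasure lborel {x. ennreal t < J x}
       \<le> (\<integral>\<^sup>+y. ennreal (g y) * indicator {y. D * t powr (q / p) < g y} y \<partial>lborel)"
  shows "(\<integral>\<^sup>+x. ennpow (J x) q \<partial>lborel)
     \<le> ennreal (p / (p - 1) * D powr (- p)) * (\<integral>\<^sup>+y. ennreal (g y powr p) \<partial>lborel)"
proof -
  \<comment> \<open>Dividing the layer weight \<open>t powr (q - 1)\<close> by the level factor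
    \<open>t powr (q / p)\<close> leaves \<open>t powr (c - 1)\<close>, integrable at 0 since
    \<open>p > 1\<close>.\<close>
  define c where "c = q - q / p"
  have c: "c > 0" "q / c = p / (p - 1)" "p / q * c = p - 1"
    using pos by (auto simp: c_def field_simps)
  have "(\<integral>\<^sup>+x. ennpow (J x) q \<partial>lborel)
     \<le> (\<integral>\<^sup>+x. (\<integral>\<^sup>+t. ennreal (q * t powr (q - 1)) * (if 0 < t \<and> ennreal t < J x then 1 else 0) \<partial>lborel) \<partial>lborel)"
    by (intro nn_integral_mono order_trans[OF ennpow_le_layers]) (auto simp: indicator_def pos)
  also have "\<dots> = (\<integral>\<^sup>+t. (\<integral>\<^sup>+x. ennreal (q * t powr (q - 1)) * (if 0 < t \<and> ennreal t < J x then 1 else 0) \<partial>lborel) \<partial>lborel)"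
    by (rule lborel_pair.Fubini'[symmetric]) measurable
  also have "\<dots> \<le> (\<integral>\<^sup>+t. (\<integral>\<^sup>+y. ennreal (q / D * t powr (c - 1)) * (ennreal (g y) * (if 0 < t \<and> D * t powr (q / p) < g y then 1 else 0)) \<partial>lborel) \<partial>lborel)"
  proof (rule nn_integral_mono)
    fix t :: real
    show "(\<integral>\<^sup>+x. ennreal (q * t powr (q - 1)) * (if 0 < t \<and> ennreal t < J x then 1 else 0) \<partial>lborel)
      \<le> (\<integral>\<^sup>+y. ennreal (q / D * t powr (c - 1)) * (ennreal (g y) * (if 0 < t \<and> D * t powr (q / p) < g y then 1 else 0)) \<partial>lborel)"
    proof (cases "t > 0")
      case True
      have e: "q * t powr (q - 1) = (q / D * t powr (c - 1)) * (D * t powr (q / p))"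
      proof -
        have "t powr (c - 1) * t powr (q / p) = t powr (q - 1)"
          by (simp flip: powr_add add: c_def)
        then show ?thesis using pos by simp
      qed
      have "(\<integral>\<^sup>+x. ennreal (q * t powr (q - 1)) * (if 0 < t \<and> ennreal t < J x then 1 else 0) \<partial>lborel)
         = (\<integral>\<^sup>+x. ennreal (q * t powr (q - 1)) * indicator {x. ennreal t < J x} x \<partial>lborel)"
        using True by (intro nn_integral_cong) (auto simp: indicator_def)
      also have "\<dots> = ennreal (q * t powr (q - 1)) * emeasure lborel {x. ennreal t < J x}"
        by (simp add: nn_integral_cmult)
      also have "\<dots> = ennreal (q / D * t powr (c - 1)) * (ennreal (D * t powr (q / p)) * emeasure lborel {x. ennreal t < J x})"
        unfolding e by (subst ennreal_mult) (use pos in \<open>auto simp: mult.assoc\<close>)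
      also have "\<dots> \<le> ennreal (q / D * t powr (c - 1)) * (\<integral>\<^sup>+y. ennreal (g y) * indicator {y. D * t powr (q / p) < g y} y \<partial>lborel)"
        by (intro mult_left_mono level True) auto
      also have "\<dots> = (\<integral>\<^sup>+y. ennreal (q / D * t powr (c - 1)) * (ennreal (g y) * (if 0 < t \<and> D * t powr (q / p) < g y then 1 else 0)) \<partial>lborel)"
        using True by (subst nn_integral_cmult[symmetric]) (auto intro!: nn_integral_cong simp: indicator_def)
      finally show ?thesis .
    qed auto
  qed
  also have "\<dots> = (\<integral>\<^sup>+y. (\<integral>\<^sup>+t. ennreal (q / D * t powr (c - 1)) * (ennreal (g y) * (if 0 < t \<and> D * t powr (q / p) < g y then 1 else 0)) \<partial>lborel) \<partial>lborel)"
    by (rule lborel_pair.Fubini') measurable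
  also have "\<dots> \<le> (\<integral>\<^sup>+y. ennreal (p / (p - 1) * D powr (- p)) * ennreal (g y powr p) \<partial>lborel)"
  proof (rule nn_integral_mono)
    fix y
    \<comment> \<open>This solves \<open>D * a powr (q / p) = g y\<close>: beyond \<open>a\<close>
      the truncation height exceeds \<open>g y\<close>, so only levels up to \<open>a\<close>
      contribute.\<close>
    define a where "a = (g y / D) powr (p / q)"
    have a: "t \<le> a" if "0 < t" "D * t powr (q / p) < g y" for t
    proof -
      have "t powr (q / p) \<le> g y / D" using that pos by (simp add: field_simps)
      then have "(t powr (q / p)) powr (p / q) \<le> a"
        unfolding a_def using pos by (intro powr_mono2) auto
      then show ?thesis using pos that by (simp add: powr_powr)
    qed
    have "(\<integral>\<^sup>+t. ennreal (q / D * t powr (c - 1)) * (ennreal (g y) * (if 0 < t \<and> D * t powr (q / p) < g y then 1 else 0)) \<partial>lborel)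
      \<le> (\<integral>\<^sup>+t. ennreal (q / D * g y) * (ennreal (t powr (c - 1)) * indicator {0..a} t) \<partial>lborel)"
      using pos g0[of y] a by (intro nn_integral_mono) (auto simp: indicator_def mult_ac simp flip: ennreal_mult')
    also have "\<dots> = ennreal (q / D * g y) * ennreal (a powr c / c)"
      using nn_integral_powr_from_0[of c a] c by (subst nn_integral_cmult) (auto simp: a_def)
    also have "\<dots> = ennreal (p / (p - 1) * D powr (- p)) * ennreal (g y powr p)"
    proof -
      have "a powr c = g y powr (p - 1) * D powr (1 - p)"
        unfolding a_def powr_powr c(3) using pos g0[of y]
        using powr_minus[of D "p - 1"] by (simp add: powr_divide) (simp add: divide_inverse)
      then have "q / D * g y * (a powr c / c) = (q / c) * ((g y powr (p - 1) * g y) * (D powr (1 - p) / D))"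
        by (simp add: mult_ac)
      also have "g y powr (p - 1) * g y = g y powr p"
        using g0[of y] powr_add[of "g y" "p - 1" 1] by (cases "g y = 0") auto
      also have "D powr (1 - p) / D = D powr (- p)"
        using pos powr_diff[of D "1 - p" 1] by simp
      finally show ?thesis unfolding c(2) using pos g0[of y] c(1) by (simp flip: ennreal_mult' add: mult_ac)
    qed
    finally show "(\<integral>\<^sup>+t. ennreal (q / D * t powr (c - 1)) * (ennreal (g y) * (if 0 < t \<and> D * t powr (q / p) < g y then 1 else 0)) \<partial>lborel)
      \<le> ennreal (p / (p - 1) * D powr (- p)) * ennreal (g y powr p)" .
  qed
  also have "\<dots> = ennreal (p / (p - 1) * D powr (- p)) * (\<integral>\<^sup>+y. ennreal (g y powr p) \<partial>lborel)"
    by (rule nn_integral_cmult) measurable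
  finally show ?thesis .
qed

section \<open>Morrey-type bounds for the Riesz potential\<close>

lemma ennpow_mono:
  assumes "u \<le> v" "q \<ge> 0"
  shows "ennpow u q \<le> ennpow v q"
  using assms by (cases u; cases v) (auto simp: powr_mono2 top_unique intro!: ennreal_leI)

lemma ennpow_add_le:
  assumes "q > 0"
  shows "ennpow (u + v) q \<le> ennreal (2 powr q) * (ennpow u q + ennpow v q)"
proof (cases u; cases v)
  fix a b :: real
  assume ab: "u = ennreal a" "a \<ge> 0" "v = ennreal b" "b \<ge> 0"
  have "(a + b) powr q \<le> (2 * max a b) powr q"
    using ab assms by (intro powr_mono2) auto
  also have "\<dots> = 2 powr q * max a b powr q"
    using ab by (simp add: powr_mult)
  also have "max a b powr q \<le> a powr q + b powr q"
    by (auto simp: max_def)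
  finally have "(a + b) powr q \<le> 2 powr q * (a powr q + b powr q)" by simp
  then show ?thesis
    using ab by (simp flip: ennreal_plus ennreal_mult')
qed (simp_all add: ennreal_mult_top)

lemma ennpow_le_mult:
  assumes "ennreal a \<le> ennreal c * u" "a \<ge> 0" "c > 0" "q > 0"
  shows "ennreal (a powr q) \<le> ennreal (c powr q) * ennpow u q"
proof (cases u)
  case (real b)
  then have "a \<le> c * b" using assms by (simp flip: ennreal_mult')
  then have "a powr q \<le> (c * b) powr q" using assms by (intro powr_mono2) auto
  then show ?thesis using real assms by (simp flip: ennreal_mult' add: powr_mult)
qed (use assms in \<open>simp add: ennreal_mult_top\<close>)

text \<open>The dimension enters as a real number \<open>n\<close>, so that the exponent arithmetic
  needs no underlying space. Lemmas about functions assume \<open>n = real DIM('a)\<close>.\<close>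

locale sobolev_exponents =
  fixes \<alpha> l p q n :: real
  assumes \<alpha>: "0 < \<alpha>" "\<alpha> < n" and l: "0 \<le> l" "l < n"
    and p: "1 < p" "p < (n - l) / \<alpha>"
    and q: "1 / q = 1 / p - \<alpha> / (n - l)"
begin

lemma p_less_q: "p < q"
proof -
  \<comment> \<open>The upper bound on \<open>p\<close> is what makes \<open>1 / q\<close>, and with
    it \<open>q\<close>, positive.\<close>
  have "\<alpha> / (n - l) < 1 / p" using \<alpha> l p by (simp add: field_simps)
  then have "1 / q > 0" using q by simp
  then have q0: "q > 0" by simp
  have "1 / q < 1 / p" using q \<alpha> l by simp
  then show ?thesis using q0 p by (simp add: field_simps)
qed

lemma q_pos: "q > 0" using p_less_q p by simp

text \<open>The left side is the gap between the kernel exponent \<open>n - \<alpha>\<close> and the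
  growth exponent \<open>n - (n - l) / p\<close> of integrals over balls, hence the decay rate of
  the far part.\<close>

lemma far_exponent: "(n - l) / p - \<alpha> = (n - l) / q"
proof -
  have "(n - l) / q = (n - l) * (1 / p - \<alpha> / (n - l))" unfolding q[symmetric] by simp
  then show ?thesis using l by (simp add: right_diff_distrib)
qed

text \<open>The far part will dictate the radius \<open>\<rho> = (B / t) powr (q / (n - l))\<close>.
  The identity then yields the power of \<open>B / t\<close> in \<open>\<rho> powr \<alpha>\<close>,
  the order of the near kernel mass.\<close>

lemma near_exponent: "q / (n - l) * \<alpha> = q / p - 1"
proof -
  have "q / (n - l) * \<alpha> = q * (1 / p - 1 / q)" unfolding q by simp
  then show ?thesis using q_pos by (simp add: right_diff_distrib)
qed

text \<open>Here \<open>K\<close> plays the role of the \<open>p\<close>-th power of the Morrey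
  norm, which avoids roots and suprema. Borel measurability makes \<open>g\<close> fit for Tonelli's
  theorem on \<open>lborel\<close>.\<close>

definition morrey_bound :: "real \<Rightarrow> ('a::euclidean_space \<Rightarrow> real) \<Rightarrow> bool" where
  "morrey_bound K g \<longleftrightarrow> g \<in> borel_measurable borel \<and> (\<forall>y. g y \<ge> 0) \<and>
     (\<forall>x r. r > 0 \<longrightarrow> (\<integral>\<^sup>+y. ennreal (g y powr p) * indicator (ball x r) y \<partial>lborel) \<le> ennreal (K * r powr l))"

lemma morrey_boundD:
  assumes "morrey_bound K g"
  shows "g \<in> borel_measurable borel" "\<And>y. g y \<ge> 0"
    "\<And>x r. r > 0 \<Longrightarrow> (\<integral>\<^sup>+y. ennreal (g y powr p) * indicator (ball x r) y \<partial>lborel) \<le> ennreal (K * r powr l)"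
  using assms by (auto simp: morrey_bound_def)

lemma morrey_bound_restrict:
  fixes g :: "'a::euclidean_space \<Rightarrow> real"
  assumes g: "morrey_bound K g" and [measurable]: "A \<in> sets borel"
  shows "morrey_bound K (\<lambda>y. g y * indicator A y)"
  unfolding morrey_bound_def
proof (intro conjI allI impI)
  note [measurable] = morrey_boundD(1)[OF g]
  show "(\<lambda>y. g y * indicator A y) \<in> borel_measurable borel" by measurable
  show "0 \<le> g y * indicator A y" for y using morrey_boundD(2)[OF g] by simp
  fix x and r :: real assume "r > 0"
  have "(\<integral>\<^sup>+y. ennreal ((g y * indicator A y) powr p) * indicator (ball x r) y \<partial>lborel)
     \<le> (\<integral>\<^sup>+y. ennreal (g y powr p) * indicator (ball x r) y \<partial>lborel)"
    by (intro nn_integral_mono mult_right_mono) (auto simp: indicator_def)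
  also have "\<dots> \<le> ennreal (K * r powr l)" by (rule morrey_boundD(3)[OF g \<open>r > 0\<close>])
  finally show "(\<integral>\<^sup>+y. ennreal ((g y * indicator A y) powr p) * indicator (ball x r) y \<partial>lborel)
     \<le> ennreal (K * r powr l)" .
qed

text \<open>The quotient is \<open>\<gamma> / (\<gamma> - \<beta>)\<close> from
  \<open>riesz_nn_far\<close>, for the exponents that occur here; the other factor is the constant
  of \<open>ball_integral_le_of_powr\<close>.\<close>

definition far_const :: real where
  "far_const = (n - \<alpha>) / ((n - l) / q) * (unit_ball_vol n + 1)"

lemma far_const_pos: "far_const > 0"
proof -
  have "unit_ball_vol n \<ge> 0" using \<alpha> by (intro unit_ball_vol_nonneg) auto
  then have "unit_ball_vol n + 1 > 0" by simp
  then show ?thesis unfolding far_const_def using \<alpha> l q_pos by simp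
qed

text \<open>By the Morrey condition, integrals of \<open>g\<close> over balls grow with exponent
  \<open>n - (n - l) / p\<close>. This lies below \<open>n - \<alpha>\<close> because
  \<open>q\<close> is positive, so the general far estimate applies.\<close>

lemma riesz_nn_far_morrey:
  fixes g :: "'a::euclidean_space \<Rightarrow> real"
  assumes n: "n = real DIM('a)" and g: "morrey_bound K g" and pos: "K > 0" "\<rho> > 0"
  shows "riesz_nn (n - \<alpha>) (\<lambda>y. ennreal (g y) * indicator (- ball x \<rho>) y) x
     \<le> ennreal (far_const * K powr (1 / p) * \<rho> powr (- ((n - l) / q)))"
proof -
  let ?\<beta> = "n - (n - l) / p"
  have e: "n - \<alpha> - ?\<beta> = (n - l) / q" using far_exponent by simp
  have "0 < (n - l) / q" using l q_pos by simp
  note [measurable] = morrey_boundD(1)[OF g]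
  have w: "unit_ball_vol n \<ge> 0" using \<alpha> by (intro unit_ball_vol_nonneg) auto
  have "riesz_nn (n - \<alpha>) (\<lambda>y. ennreal (g y) * indicator (- ball x \<rho>) y) x
      \<le> ennreal ((n - \<alpha>) / (n - \<alpha> - ?\<beta>) * ((unit_ball_vol n + 1) * K powr (1 / p)) * \<rho> powr (?\<beta> - (n - \<alpha>)))"
  proof (rule riesz_nn_far)
    show "(\<integral>\<^sup>+y. ennreal (g y) * indicator (ball x r) y \<partial>lborel)
        \<le> ennreal ((unit_ball_vol n + 1) * K powr (1 / p) * r powr ?\<beta>)" if "r > \<rho>" for r
      unfolding n by (rule ball_integral_le_of_powr)
        (use that pos p g in \<open>auto simp: morrey_boundD n\<close>)
    show "?\<beta> < n - \<alpha>" using e \<open>0 < (n - l) / q\<close> by simp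
  qed (use \<alpha> pos w in auto)
  also have "?\<beta> - (n - \<alpha>) = - ((n - l) / q)" using e by simp
  finally show ?thesis unfolding e far_const_def by (simp add: mult.assoc)
qed

text \<open>Once \<open>\<rho>\<close> is fixed by the far estimate at level \<open>t\<close>, the
  truncation height becomes a pure power \<open>D * t powr (q / p)\<close>, the form that
  \<open>strong_type_of_level_sets\<close> requires.\<close>

lemma riesz_nn_strong_type:
  assumes n: "n = real DIM('a::euclidean_space)"
  obtains C where "C > 0" "\<And>K (g :: 'a \<Rightarrow> real). K > 0 \<Longrightarrow> morrey_bound K g \<Longrightarrow>
     (\<integral>\<^sup>+x. ennpow (riesz_nn (n - \<alpha>) (\<lambda>y. ennreal (g y)) x) q \<partial>lborel)
       \<le> ennreal (C * K powr ((q - p) / p)) * (\<integral>\<^sup>+y. ennreal (g y powr p) \<partial>lborel)"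
proof -
  \<comment> \<open>By the near estimate with kernel exponent \<open>n - \<alpha>\<close>, the
    kernel mass of a ball of radius \<open>\<rho>\<close> is at most
    \<open>N * \<rho> powr \<alpha>\<close>.\<close>
  define N where "N = unit_ball_vol n * ((n - \<alpha>) / (n - (n - \<alpha>)) + 1)"
  have N: "N > 0" using \<alpha> by (auto simp: N_def intro!: mult_pos_pos add_pos_pos)
  define C where "C = p / (p - 1) * ((3 * N) powr p * (3 * far_const) powr (q - p))"
  have C: "C > 0" using p N far_const_pos by (simp add: C_def)
  have "(\<integral>\<^sup>+x. ennpow (riesz_nn (n - \<alpha>) (\<lambda>y. ennreal (g y)) x) q \<partial>lborel)
       \<le> ennreal (C * K powr ((q - p) / p)) * (\<integral>\<^sup>+y. ennreal (g y powr p) \<partial>lborel)"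
    if K: "K > 0" and g: "morrey_bound K g" for K and g :: "'a \<Rightarrow> real"
  proof -
    note [measurable] = morrey_boundD(1)[OF g]
    \<comment> \<open>Three times the coefficient of the far estimate: equating the far bound with
      \<open>t / 3\<close> means \<open>\<rho> powr ((n - l) / q) = B / t\<close>.\<close>
    define B where "B = 3 * far_const * K powr (1 / p)"
    have B: "B > 0" using K far_const_pos by (simp add: B_def)
    \<comment> \<open>This is the coefficient of \<open>t powr (q / p)\<close> in the truncation
      height \<open>t / (3 * N * \<rho> powr \<alpha>)\<close>.\<close>
    define D where "D = 1 / (3 * N * B powr (q / p - 1))"
    have D: "D > 0" using N B by (simp add: D_def)
    have "(\<integral>\<^sup>+x. ennpow (riesz_nn (n - \<alpha>) (\<lambda>y. ennreal (g y)) x) q \<partial>lborel)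
       \<le> ennreal (p / (p - 1) * D powr (- p)) * (\<integral>\<^sup>+y. ennreal (g y powr p) \<partial>lborel)"
    proof (rule strong_type_of_level_sets)
      fix t :: real assume t: "t > 0"
      define \<rho> where "\<rho> = (B / t) powr (q / (n - l))"
      have \<rho>: "\<rho> > 0" using B t by (simp add: \<rho>_def)
      have far: "far_const * K powr (1 / p) * \<rho> powr (- ((n - l) / q)) = t / 3"
      proof -
        have "\<rho> powr (- ((n - l) / q)) = (B / t) powr (- 1)"
          unfolding \<rho>_def powr_powr using q_pos l by simp
        also have "\<dots> = t / B" using B t by (simp add: powr_minus)
        finally show ?thesis using K far_const_pos by (simp add: B_def)
      qed
      have near: "t / (3 * (N * \<rho> powr \<alpha>)) = D * t powr (q / p)"
      proof -
        have "\<rho> powr \<alpha> = (B / t) powr (q / p - 1)"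
          unfolding \<rho>_def powr_powr near_exponent ..
        also have "\<dots> = B powr (q / p - 1) / t powr (q / p - 1)"
          using B t by (simp add: powr_divide)
        finally have "t / (3 * (N * \<rho> powr \<alpha>)) = D * (t * t powr (q / p - 1))"
          by (simp add: D_def)
        also have "t * t powr (q / p - 1) = t powr (q / p)"
          using t powr_add[of t 1 "q / p - 1"] by simp
        finally show ?thesis .
      qed
      show "ennreal (D * t powr (q / p)) * emeasure lborel {x. ennreal t < riesz_nn (n - \<alpha>) (\<lambda>y. ennreal (g y)) x}
         \<le> (\<integral>\<^sup>+y. ennreal (g y) * indicator {y. D * t powr (q / p) < g y} y \<partial>lborel)"
        unfolding near[symmetric]
      proof (rule level_set_estimate)
        show "riesz_nn (n - \<alpha>) (indicator (ball x \<rho>)) x \<le> ennreal (N * \<rho> powr \<alpha>)" for x :: 'a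
          using riesz_nn_near[of "n - \<alpha>" \<rho> x] \<alpha> \<rho> by (simp add: N_def n)
        show "riesz_nn (n - \<alpha>) (\<lambda>y. ennreal (g y) * indicator (- ball x \<rho>) y) x \<le> ennreal (t / 3)" for x :: 'a
          using riesz_nn_far_morrey[OF n g K \<rho>] unfolding far .
      qed (use t N \<rho> morrey_boundD[OF g] in auto)
    qed (use D q_pos p morrey_boundD[OF g] in auto)
    also have "p / (p - 1) * D powr (- p) = C * K powr ((q - p) / p)"
    proof -
      have "D powr (- p) = (3 * N * B powr (q / p - 1)) powr p"
        using N B by (simp add: D_def powr_minus powr_divide)
      also have "\<dots> = (3 * N) powr p * B powr ((q / p - 1) * p)"
        using N by (simp add: powr_mult powr_powr)
      also have "(q / p - 1) * p = q - p" using p by (simp add: field_simps)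
      also have "B powr (q - p) = (3 * far_const) powr (q - p) * K powr ((q - p) / p)"
        using far_const_pos by (simp add: B_def powr_mult powr_powr)
      finally show ?thesis by (simp add: C_def)
    qed
    finally show ?thesis .
  qed
  with C show thesis by (rule that)
qed

text \<open>Inside \<open>ball z (r + s)\<close> the strong type bound applies. The rest of
  \<open>g\<close> has distance at least \<open>s\<close> from \<open>ball z r\<close>, so its
  potential there is bounded by a constant, whose \<open>q\<close>-th power is multiplied by the
  volume of \<open>ball z r\<close>. The radii stay independent to allow both \<open>s = r\<close>
  and \<open>r = 1\<close> with \<open>s\<close> large.\<close>

lemma riesz_nn_local:
  assumes n: "n = real DIM('a::euclidean_space)"
  obtains C where "C > 0" "\<And>K r s (g :: 'a \<Rightarrow> real) z. K > 0 \<Longrightarrow> r > 0 \<Longrightarrow> s > 0 \<Longrightarrow> morrey_bound K g \<Longrightarrow>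
     (\<integral>\<^sup>+x. ennpow (riesz_nn (n - \<alpha>) (\<lambda>y. ennreal (g y)) x) q * indicator (ball z r) x \<partial>lborel)
       \<le> ennreal (C * K powr ((q - p) / p)) * (\<integral>\<^sup>+y. ennreal (g y powr p) * indicator (ball z (r + s)) y \<partial>lborel)
         + ennreal (C * K powr (q / p) * r powr n * s powr (- (n - l)))"
proof -
  obtain C0 where C0: "C0 > 0" and strong: "\<And>K (g :: 'a \<Rightarrow> real). K > 0 \<Longrightarrow> morrey_bound K g \<Longrightarrow>
     (\<integral>\<^sup>+x. ennpow (riesz_nn (n - \<alpha>) (\<lambda>y. ennreal (g y)) x) q \<partial>lborel)
       \<le> ennreal (C0 * K powr ((q - p) / p)) * (\<integral>\<^sup>+y. ennreal (g y powr p) \<partial>lborel)"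
    using riesz_nn_strong_type[OF n] by blast
  let ?w = "unit_ball_vol n"
  have w: "?w > 0" using \<alpha> by simp
  define C1 where "C1 = ?w * far_const powr q"
  have C1: "C1 > 0" using w far_const_pos by (simp add: C1_def)
  define C where "C = 2 powr q * max C0 C1"
  have "(\<integral>\<^sup>+x. ennpow (riesz_nn (n - \<alpha>) (\<lambda>y. ennreal (g y)) x) q * indicator (ball z r) x \<partial>lborel)
       \<le> ennreal (C * K powr ((q - p) / p)) * (\<integral>\<^sup>+y. ennreal (g y powr p) * indicator (ball z (r + s)) y \<partial>lborel)
         + ennreal (C * K powr (q / p) * r powr n * s powr (- (n - l)))"
    if pos: "K > 0" "r > 0" "s > 0" and g: "morrey_bound K g" for K r s and g :: "'a \<Rightarrow> real" and z
  proof -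
    note [measurable] = morrey_boundD(1)[OF g]
    define h where "h y = g y * indicator (ball z (r + s)) y" for y
    have h: "morrey_bound K h" unfolding h_def[abs_def] by (rule morrey_bound_restrict[OF g]) simp
    note [measurable] = morrey_boundD(1)[OF h]
    define b where "b = far_const * K powr (1 / p) * s powr (- ((n - l) / q))"
    have b: "b \<ge> 0" using far_const_pos by (simp add: b_def)
    have split: "riesz_nn (n - \<alpha>) (\<lambda>y. ennreal (g y)) x \<le> riesz_nn (n - \<alpha>) (\<lambda>y. ennreal (h y)) x + ennreal b"
      if x: "x \<in> ball z r" for x
    proof -
      \<comment> \<open>Consequently, whatever \<open>h\<close> discards lies outside
        \<open>ball x s\<close> and is caught by the far part.\<close>
      have "y \<in> ball z (r + s)" if "y \<in> ball x s" for y
        using x that dist_triangle[of z y x] by simp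
      then have "riesz_nn (n - \<alpha>) (\<lambda>y. ennreal (g y)) x
         \<le> riesz_nn (n - \<alpha>) (\<lambda>y. ennreal (h y) + ennreal (g y) * indicator (- ball x s) y) x"
        by (intro riesz_nn_mono) (auto simp: h_def indicator_def)
      also have "\<dots> = riesz_nn (n - \<alpha>) (\<lambda>y. ennreal (h y)) x
          + riesz_nn (n - \<alpha>) (\<lambda>y. ennreal (g y) * indicator (- ball x s) y) x"
        by (rule riesz_nn_add) measurable
      also have "\<dots> \<le> riesz_nn (n - \<alpha>) (\<lambda>y. ennreal (h y)) x + ennreal b"
        unfolding b_def by (intro add_left_mono riesz_nn_far_morrey[OF n g] pos)
      finally show ?thesis .
    qed
    have "(\<integral>\<^sup>+x. ennpow (riesz_nn (n - \<alpha>) (\<lambda>y. ennreal (g y)) x) q * indicator (ball z r) x \<partial>lborel)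
       \<le> (\<integral>\<^sup>+x. ennreal (2 powr q) * (ennpow (riesz_nn (n - \<alpha>) (\<lambda>y. ennreal (h y)) x) q
            + ennreal (b powr q) * indicator (ball z r) x) \<partial>lborel)"
    proof (rule nn_integral_mono)
      fix x
      show "ennpow (riesz_nn (n - \<alpha>) (\<lambda>y. ennreal (g y)) x) q * indicator (ball z r) x
         \<le> ennreal (2 powr q) * (ennpow (riesz_nn (n - \<alpha>) (\<lambda>y. ennreal (h y)) x) q
            + ennreal (b powr q) * indicator (ball z r) x)"
      proof (cases "x \<in> ball z r")
        case True
        have "ennpow (riesz_nn (n - \<alpha>) (\<lambda>y. ennreal (g y)) x) q
          \<le> ennpow (riesz_nn (n - \<alpha>) (\<lambda>y. ennreal (h y)) x + ennreal b) q"
          using split[OF True] q_pos by (intro ennpow_mono) auto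
        also have "\<dots> \<le> ennreal (2 powr q) * (ennpow (riesz_nn (n - \<alpha>) (\<lambda>y. ennreal (h y)) x) q + ennpow (ennreal b) q)"
          by (rule ennpow_add_le[OF q_pos])
        finally show ?thesis using True b by simp
      qed simp
    qed
    also have "\<dots> = ennreal (2 powr q) * ((\<integral>\<^sup>+x. ennpow (riesz_nn (n - \<alpha>) (\<lambda>y. ennreal (h y)) x) q \<partial>lborel)
            + ennreal (b powr q) * emeasure lborel (ball z r))"
      by (simp add: nn_integral_cmult nn_integral_add)
    also have "\<dots> \<le> ennreal (2 powr q) * (ennreal (C0 * K powr ((q - p) / p)) * (\<integral>\<^sup>+y. ennreal (h y powr p) \<partial>lborel)
            + ennreal (b powr q) * ennreal (?w * r powr n))"
      using pos by (intro mult_left_mono add_mono strong h) (auto simp: emeasure_ball n powr_realpow)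
    also have "(\<integral>\<^sup>+y. ennreal (h y powr p) \<partial>lborel) = (\<integral>\<^sup>+y. ennreal (g y powr p) * indicator (ball z (r + s)) y \<partial>lborel)"
      using p by (intro nn_integral_cong) (auto simp: h_def indicator_def)
    also have "ennreal (b powr q) * ennreal (?w * r powr n) = ennreal (C1 * K powr (q / p) * r powr n * s powr (- (n - l)))"
    proof -
      have "b powr q = far_const powr q * K powr (q / p) * s powr (- (n - l))"
        using far_const_pos q_pos by (simp add: b_def powr_mult powr_powr)
      then show ?thesis using w by (simp flip: ennreal_mult' add: C1_def mult_ac)
    qed
    finally have "(\<integral>\<^sup>+x. ennpow (riesz_nn (n - \<alpha>) (\<lambda>y. ennreal (g y)) x) q * indicator (ball z r) x \<partial>lborel)
      \<le> ennreal (2 powr q * (C0 * K powr ((q - p) / p))) * (\<integral>\<^sup>+y. ennreal (g y powr p) * indicator (ball z (r + s)) y \<partial>lborel)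
        + ennreal (2 powr q * (C1 * K powr (q / p) * r powr n * s powr (- (n - l))))"
      using C0 C1 by (simp add: distrib_left ennreal_mult' mult.assoc)
    also have "\<dots> \<le> ennreal (C * K powr ((q - p) / p)) * (\<integral>\<^sup>+y. ennreal (g y powr p) * indicator (ball z (r + s)) y \<partial>lborel)
         + ennreal (C * K powr (q / p) * r powr n * s powr (- (n - l)))"
    proof (intro add_mono mult_right_mono ennreal_leI)
      show "2 powr q * (C0 * K powr ((q - p) / p)) \<le> C * K powr ((q - p) / p)"
        by (simp add: C_def mult_right_mono)
      have "C1 * (K powr (q / p) * r powr n * s powr (- (n - l))) \<le> max C0 C1 * (K powr (q / p) * r powr n * s powr (- (n - l)))"
        by (intro mult_right_mono) auto
      then show "2 powr q * (C1 * K powr (q / p) * r powr n * s powr (- (n - l))) \<le> C * K powr (q / p) * r powr n * s powr (- (n - l))"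
        by (simp add: C_def mult.assoc)
    qed simp
    finally show ?thesis .
  qed
  moreover have "C > 0" using C0 by (simp add: C_def)
  ultimately show thesis by (intro that)
qed

end

section \<open>Covering balls by unit balls\<close>

lemma ball_cover_unit_balls:
  obtains F :: "'a::euclidean_space set" where "finite F" "\<And>z. ball z s \<subseteq> (\<Union>a\<in>F. ball (z + a) 1)"
proof -
  have "compact (cball (0::'a) s)" by simp
  then obtain F where F: "finite F" "cball (0::'a) s \<subseteq> (\<Union>a\<in>F. ball a 1)"
  proof (rule compactE_image[of _ UNIV "\<lambda>a. ball a 1"])
    show "cball 0 s \<subseteq> (\<Union>a. ball (a::'a) 1)"
    proof
      fix x :: 'a
      show "x \<in> (\<Union>a. ball a 1)" by (rule UN_I[of x]) auto
    qed
  qed auto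
  \<comment> \<open>One finite cover at the origin is translated, so the number of unit balls does
    not depend on \<open>z\<close>.\<close>
  have "ball z s \<subseteq> (\<Union>a\<in>F. ball (z + a) 1)" for z
  proof
    fix y assume "y \<in> ball z s"
    then have "y - z \<in> cball 0 s" by (simp add: dist_norm norm_minus_commute)
    then obtain a where "a \<in> F" "y - z \<in> ball a 1" using F by auto
    then show "y \<in> (\<Union>a\<in>F. ball (z + a) 1)"
      by (auto simp: dist_norm algebra_simps intro!: bexI[of _ a])
  qed
  with F(1) show thesis by (rule that)
qed

text \<open>The vanishing condition controls unit balls only, whereas the local estimate needs
  larger ones. The factor \<open>m\<close> counts the covering balls and depends on \<open>s\<close>
  alone.\<close>

lemma nn_integral_ball_le_unit_balls:
  obtains m :: real where "m \<ge> 0" "\<And>(h :: 'a::euclidean_space \<Rightarrow> ennreal) z. h \<in> borel_measurable borel \<Longrightarrow>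
    (\<integral>\<^sup>+y. h y * indicator (ball z s) y \<partial>lborel) \<le> ennreal m * (SUP x. \<integral>\<^sup>+y. h y * indicator (ball x 1) y \<partial>lborel)"
proof -
  obtain F :: "'a set" where F: "finite F" "\<And>z. ball z s \<subseteq> (\<Union>a\<in>F. ball (z + a) 1)"
    using ball_cover_unit_balls[of s] by blast
  have "(\<integral>\<^sup>+y. h y * indicator (ball z s) y \<partial>lborel) \<le> ennreal (card F) * (SUP x. \<integral>\<^sup>+y. h y * indicator (ball x 1) y \<partial>lborel)"
    if [measurable]: "h \<in> borel_measurable borel" for h :: "'a \<Rightarrow> ennreal" and z
  proof -
    have "(\<integral>\<^sup>+y. h y * indicator (ball z s) y \<partial>lborel) \<le> (\<integral>\<^sup>+y. (\<Sum>a\<in>F. h y * indicator (ball (z + a) 1) y) \<partial>lborel)"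
    proof (rule nn_integral_mono)
      fix y
      show "h y * indicator (ball z s) y \<le> (\<Sum>a\<in>F. h y * indicator (ball (z + a) 1) y)"
      proof (cases "y \<in> ball z s")
        case True
        then obtain a where a: "a \<in> F" "y \<in> ball (z + a) 1" using F(2) by blast
        then have "h y * indicator (ball (z + a) 1) y \<le> (\<Sum>a\<in>F. h y * indicator (ball (z + a) 1) y)"
          using F(1) by (intro member_le_sum) auto
        then show ?thesis using True a by simp
      qed simp
    qed
    also have "\<dots> = (\<Sum>a\<in>F. \<integral>\<^sup>+y. h y * indicator (ball (z + a) 1) y \<partial>lborel)"
      by (rule nn_integral_sum) measurable
    also have "\<dots> \<le> (\<Sum>a\<in>F. SUP x. \<integral>\<^sup>+y. h y * indicator (ball x 1) y \<partial>lborel)"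
      by (intro sum_mono SUP_upper) auto
    also have "\<dots> = ennreal (card F) * (SUP x. \<integral>\<^sup>+y. h y * indicator (ball x 1) y \<partial>lborel)"
      by (simp add: ennreal_of_nat_eq_real_of_nat)
    finally show ?thesis .
  qed
  then show thesis by (intro that[of "real (card F)"]) auto
qed

section \<open>Morrey bound and vanishing condition for the potential\<close>

context sobolev_exponents
begin

text \<open>With \<open>s = r\<close> and \<open>K = M powr p\<close>, both terms of the local
  estimate scale as \<open>M powr q * r powr l\<close>.\<close>

lemma riesz_nn_morrey:
  assumes n: "n = real DIM('a::euclidean_space)"
  obtains C where "C > 0" "\<And>M r (g :: 'a \<Rightarrow> real) z. M > 0 \<Longrightarrow> r > 0 \<Longrightarrow> morrey_bound (M powr p) g \<Longrightarrow>
     (\<integral>\<^sup>+x. ennpow (riesz_nn (n - \<alpha>) (\<lambda>y. ennreal (g y)) x) q * indicator (ball z r) x \<partial>lborel)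
       \<le> ennreal (C * M powr q * r powr l)"
proof -
  obtain C where C: "C > 0" and loc: "\<And>K r s (g :: 'a \<Rightarrow> real) z. K > 0 \<Longrightarrow> r > 0 \<Longrightarrow> s > 0 \<Longrightarrow> morrey_bound K g \<Longrightarrow>
     (\<integral>\<^sup>+x. ennpow (riesz_nn (n - \<alpha>) (\<lambda>y. ennreal (g y)) x) q * indicator (ball z r) x \<partial>lborel)
       \<le> ennreal (C * K powr ((q - p) / p)) * (\<integral>\<^sup>+y. ennreal (g y powr p) * indicator (ball z (r + s)) y \<partial>lborel)
         + ennreal (C * K powr (q / p) * r powr n * s powr (- (n - l)))"
    using riesz_nn_local[OF n] by blast
  have "(\<integral>\<^sup>+x. ennpow (riesz_nn (n - \<alpha>) (\<lambda>y. ennreal (g y)) x) q * indicator (ball z r) x \<partial>lborel)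
       \<le> ennreal (C * (2 powr l + 1) * M powr q * r powr l)"
    if M: "M > 0" and r: "r > 0" and g: "morrey_bound (M powr p) g" for M r and g :: "'a \<Rightarrow> real" and z
  proof -
    have "(\<integral>\<^sup>+x. ennpow (riesz_nn (n - \<alpha>) (\<lambda>y. ennreal (g y)) x) q * indicator (ball z r) x \<partial>lborel)
     \<le> ennreal (C * (M powr p) powr ((q - p) / p)) * (\<integral>\<^sup>+y. ennreal (g y powr p) * indicator (ball z (r + r)) y \<partial>lborel)
         + ennreal (C * (M powr p) powr (q / p) * r powr n * r powr (- (n - l)))"
      by (rule loc) (use M r g in auto)
    also have "\<dots> \<le> ennreal (C * (M powr p) powr ((q - p) / p)) * ennreal (M powr p * (r + r) powr l)
         + ennreal (C * (M powr p) powr (q / p) * r powr n * r powr (- (n - l)))"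
      by (intro add_right_mono mult_left_mono morrey_boundD(3)[OF g]) (use r in auto)
    also have "\<dots> = ennreal (C * (M powr p) powr ((q - p) / p) * (M powr p * (r + r) powr l)
         + C * (M powr p) powr (q / p) * r powr n * r powr (- (n - l)))"
      using C by (simp flip: ennreal_mult' ennreal_plus)
    also have "C * (M powr p) powr ((q - p) / p) * (M powr p * (r + r) powr l)
         + C * (M powr p) powr (q / p) * r powr n * r powr (- (n - l)) = C * (2 powr l + 1) * M powr q * r powr l"
    proof -
      have 1: "(M powr p) powr ((q - p) / p) * M powr p = M powr q"
        using p by (simp add: powr_powr flip: powr_add)
      have 2: "(r + r) powr l = 2 powr l * r powr l"
        using r powr_mult[of 2 r l] by simp
      have 3: "(M powr p) powr (q / p) = M powr q" using p by (simp add: powr_powr)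
      have 4: "r powr n * r powr (- (n - l)) = r powr l" by (simp flip: powr_add)
      have "C * (M powr p) powr ((q - p) / p) * (M powr p * (r + r) powr l)
         + C * (M powr p) powr (q / p) * r powr n * r powr (- (n - l))
        = C * ((M powr p) powr ((q - p) / p) * M powr p) * (r + r) powr l
         + C * (M powr p) powr (q / p) * (r powr n * r powr (- (n - l)))"
        by simp
      then show ?thesis unfolding 1 2 3 4 by (simp add: algebra_simps)
    qed
    finally show ?thesis .
  qed
  moreover have "C * (2 powr l + 1) > 0" using C by (simp add: add_pos_pos)
  ultimately show thesis by (intro that)
qed

text \<open>In the local estimate with \<open>r = 1\<close>, first \<open>s\<close> is chosen to
  make the remainder less than \<open>e / 2\<close> for all centres. Then \<open>N\<close> is taken
  large for the main term, whose constant depends on \<open>s\<close> through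
  \<open>m\<close>.\<close>

lemma riesz_nn_vanishing:
  fixes g :: "'a::euclidean_space \<Rightarrow> real"
  assumes n: "n = real DIM('a)" and K: "K > 0" and g: "morrey_bound K g"
    and van: "(\<lambda>N::nat. SUP x. \<integral>\<^sup>+y. ennreal (g y powr p) * indicator (- ball 0 (real N)) y * indicator (ball x 1) y \<partial>lborel) \<longlonglongrightarrow> 0"
  shows "(\<lambda>N::nat. SUP x. \<integral>\<^sup>+y. ennpow (riesz_nn (n - \<alpha>) (\<lambda>y. ennreal (g y)) y) q
            * indicator (- ball 0 (real N)) y * indicator (ball x 1) y \<partial>lborel) \<longlonglongrightarrow> 0"
    (is "?W \<longlonglongrightarrow> 0")
proof (rule order_tendstoI)
  fix a :: ennreal assume "a > 0"
  \<comment> \<open>Since \<open>a\<close> may be infinite, a finite positive number below it serves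
    as the tolerance.\<close>
  then obtain b where b: "0 < b" "b < a" using dense by blast
  define e where "e = enn2real b"
  have "b < top" using b(2) by (rule order_less_le_trans) simp
  then have e: "e > 0" "ennreal e < a" using b by (auto simp: e_def enn2real_positive_iff)
  obtain C where C: "C > 0" and loc: "\<And>K r s (g :: 'a \<Rightarrow> real) z. K > 0 \<Longrightarrow> r > 0 \<Longrightarrow> s > 0 \<Longrightarrow> morrey_bound K g \<Longrightarrow>
     (\<integral>\<^sup>+x. ennpow (riesz_nn (n - \<alpha>) (\<lambda>y. ennreal (g y)) x) q * indicator (ball z r) x \<partial>lborel)
       \<le> ennreal (C * K powr ((q - p) / p)) * (\<integral>\<^sup>+y. ennreal (g y powr p) * indicator (ball z (r + s)) y \<partial>lborel)
         + ennreal (C * K powr (q / p) * r powr n * s powr (- (n - l)))"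
    using riesz_nn_local[OF n] by blast
  have "((\<lambda>s. C * K powr (q / p) * s powr (- (n - l))) \<longlongrightarrow> C * K powr (q / p) * 0) at_top"
    using l by (intro tendsto_intros tendsto_neg_powr filterlim_ident) auto
  then have "eventually (\<lambda>s. C * K powr (q / p) * s powr (- (n - l)) < e / 2) at_top"
    using e by (intro order_tendstoD) auto
  then obtain s where s: "s > 0" "C * K powr (q / p) * s powr (- (n - l)) < e / 2"
    using eventually_gt_at_top[of 0] by (metis (mono_tags, lifting) eventually_conj eventually_happens trivial_limit_at_top_linorder)
  obtain m where m: "m \<ge> 0" "\<And>(h :: 'a \<Rightarrow> ennreal) z. h \<in> borel_measurable borel \<Longrightarrow>
    (\<integral>\<^sup>+y. h y * indicator (ball z (1 + s)) y \<partial>lborel) \<le> ennreal m * (SUP x. \<integral>\<^sup>+y. h y * indicator (ball x 1) y \<partial>lborel)"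
    using nn_integral_ball_le_unit_balls[of "1 + s"] by blast
  \<comment> \<open>If \<open>ball z 1\<close> has a point of norm at least \<open>N + k\<close>,
    every point of \<open>ball z (1 + s)\<close> is within \<open>1 + (1 + s)\<close> of it, hence
    outside \<open>ball 0 N\<close>.\<close>
  define k where "k = nat \<lceil>2 + s\<rceil>"
  have k: "real k \<ge> 2 + s" unfolding k_def using s by linarith
  let ?V = "\<lambda>N::nat. SUP x. \<integral>\<^sup>+y. ennreal (g y powr p) * indicator (- ball 0 (real N)) y * indicator (ball x 1) y \<partial>lborel"
  let ?J = "\<lambda>x. ennpow (riesz_nn (n - \<alpha>) (\<lambda>y. ennreal (g y)) x) q"
  note [measurable] = morrey_boundD(1)[OF g]
  have W: "?W (N + k) \<le> ennreal (C * K powr ((q - p) / p) * m) * ?V N + ennreal (e / 2)" for N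
  proof (rule SUP_least)
    fix z :: 'a
    show "(\<integral>\<^sup>+y. ?J y * indicator (- ball 0 (real (N + k))) y * indicator (ball z 1) y \<partial>lborel)
       \<le> ennreal (C * K powr ((q - p) / p) * m) * ?V N + ennreal (e / 2)"
    proof (cases "ball z 1 \<subseteq> ball 0 (real (N + k))")
      case True
      then have "(\<lambda>y. ?J y * indicator (- ball 0 (real (N + k))) y * indicator (ball z 1) y) = (\<lambda>_. 0)"
        by (auto simp: fun_eq_iff indicator_def)
      then show ?thesis by simp
    next
      case False
      then obtain x where x: "dist z x < 1" "norm x \<ge> real N + real k" by (auto simp: subset_eq)
      have far: "y \<notin> ball 0 (real N)" if "y \<in> ball z (1 + s)" for y
      proof -
        have "norm x \<le> norm y + dist y x" using norm_triangle_ineq2[of x y] by (simp add: dist_norm norm_minus_commute)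
        also have "dist y x \<le> dist z y + dist z x" by (rule dist_triangle3)
        finally show ?thesis using that x k by simp
      qed
      have "(\<integral>\<^sup>+y. ?J y * indicator (- ball 0 (real (N + k))) y * indicator (ball z 1) y \<partial>lborel)
          \<le> (\<integral>\<^sup>+y. ?J y * indicator (ball z 1) y \<partial>lborel)"
        by (intro nn_integral_mono) (auto simp: indicator_def)
      also have "\<dots> \<le> ennreal (C * K powr ((q - p) / p)) * (\<integral>\<^sup>+y. ennreal (g y powr p) * indicator (ball z (1 + s)) y \<partial>lborel)
         + ennreal (C * K powr (q / p) * 1 powr n * s powr (- (n - l)))"
        by (rule loc) (use K s g in auto)
      also have "(\<integral>\<^sup>+y. ennreal (g y powr p) * indicator (ball z (1 + s)) y \<partial>lborel)
         = (\<integral>\<^sup>+y. (ennreal (g y powr p) * indicator (- ball 0 (real N)) y) * indicator (ball z (1 + s)) y \<partial>lborel)"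
        using far by (intro nn_integral_cong) (auto simp: indicator_def)
      also have "ennreal (C * K powr ((q - p) / p)) * \<dots>
          + ennreal (C * K powr (q / p) * 1 powr n * s powr (- (n - l)))
        \<le> ennreal (C * K powr ((q - p) / p)) * (ennreal m * ?V N) + ennreal (e / 2)"
        using s by (intro add_mono mult_left_mono m(2) ennreal_leI) auto
      also have "\<dots> = ennreal (C * K powr ((q - p) / p) * m) * ?V N + ennreal (e / 2)"
        using C m by (simp add: ennreal_mult' mult.assoc)
      finally show ?thesis .
    qed
  qed
  have "(\<lambda>N. ennreal (C * K powr ((q - p) / p) * m) * ?V N) \<longlonglongrightarrow> ennreal (C * K powr ((q - p) / p) * m) * 0"
    by (intro ennreal_tendsto_cmult van) simp
  then have "eventually (\<lambda>N. ennreal (C * K powr ((q - p) / p) * m) * ?V N < ennreal (e / 2)) sequentially"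
    using e by (intro order_tendstoD(2)[where y = 0]) (auto simp: ennreal_less_zero_iff)
  then have "eventually (\<lambda>N. ?W (N + k) < a) sequentially"
  proof eventually_elim
    case (elim N)
    have "?W (N + k) \<le> ennreal (C * K powr ((q - p) / p) * m) * ?V N + ennreal (e / 2)" by (rule W)
    also have "\<dots> \<le> ennreal (e / 2) + ennreal (e / 2)" using elim by (intro add_right_mono) simp
    also have "\<dots> = ennreal e" using e by (simp flip: ennreal_plus)
    also have "\<dots> < a" by (rule e)
    finally show ?case .
  qed
  then show "eventually (\<lambda>N. ?W N < a) sequentially"
    by (rule eventually_sequentially_seg[THEN iffD1])
qed (simp add: not_less)

end

section \<open>From Bochner integrals and Lebesgue functions to nonnegative integrals and Borel
  functions\<close>

lemma locally_p_integrableI: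
  fixes f :: "'a::euclidean_space \<Rightarrow> 'b::euclidean_space"
  assumes [measurable]: "f \<in> borel_measurable lebesgue"
    and fin: "\<And>r. r > 0 \<Longrightarrow> (\<integral>\<^sup>+y. ennreal (norm (f y) powr p) * indicator (ball 0 r) y \<partial>lborel) < \<infinity>"
  shows "locally_p_integrable p f"
  unfolding locally_p_integrable_def
proof (intro conjI allI impI assms(1))
  fix K :: "'a set" assume K: "compact K"
  then obtain r where r: "r > 0" "K \<subseteq> ball 0 r"
    using compact_imp_bounded bounded_subset_ballD[of K 0] by metis
  have [measurable]: "K \<in> sets lebesgue" using K by (simp add: borel_compact)
  have "(\<integral>\<^sup>+y. ennreal (norm (indicator K y *\<^sub>R norm (f y) powr p)) \<partial>lebesgue)
     \<le> (\<integral>\<^sup>+y. ennreal (norm (f y) powr p) * indicator (ball 0 r) y \<partial>lebesgue)"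
    using r by (intro nn_integral_mono) (auto simp: indicator_def)
  also have "\<dots> < \<infinity>" using fin[OF r(1)] by (simp add: nn_integral_completion)
  finally show "set_integrable lebesgue K (\<lambda>y. norm (f y) powr p)"
    unfolding set_integrable_def by (intro integrableI_bounded) auto
qed

text \<open>The closed ball is compact, so local integrability rules out the default value 0 of a
  divergent Bochner integral.\<close>

lemma locally_p_integrable_ball:
  fixes f :: "'a::euclidean_space \<Rightarrow> 'b::euclidean_space"
  assumes "locally_p_integrable p f"
  shows "ennreal (LINT y:ball x r|lebesgue. norm (f y) powr p)
    = (\<integral>\<^sup>+y. ennreal (norm (f y) powr p) * indicator (ball x r) y \<partial>lborel)"
proof -
  have "set_integrable lebesgue (cball x r) (\<lambda>y. norm (f y) powr p)"
    using assms by (simp add: locally_p_integrable_def)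
  then have "set_integrable lebesgue (ball x r) (\<lambda>y. norm (f y) powr p)"
    by (rule set_integrable_subset) auto
  then have "ennreal (LINT y:ball x r|lebesgue. norm (f y) powr p)
     = (\<integral>\<^sup>+y. ennreal (indicator (ball x r) y *\<^sub>R norm (f y) powr p) \<partial>lebesgue)"
    unfolding set_lebesgue_integral_def set_integrable_def
    by (intro nn_integral_eq_integral[symmetric]) auto
  then show ?thesis
    by (simp add: nn_integral_completion ennreal_mult' ennreal_indicator mult.commute)
qed

text \<open>Raising to the power \<open>p\<close> turns a norm bound into the integral inequality of
  \<open>morrey_bound\<close> with \<open>K = M powr p\<close>.\<close>

lemma morrey_norm_le_iff:
  fixes f :: "'a::euclidean_space \<Rightarrow> 'b::euclidean_space"
  assumes f: "locally_p_integrable p f" and p: "p > 0" and M: "M \<ge> 0"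
  shows "morrey_norm p l f \<le> ennreal M \<longleftrightarrow>
    (\<forall>x r. r > 0 \<longrightarrow> (\<integral>\<^sup>+y. ennreal (norm (f y) powr p) * indicator (ball x r) y \<partial>lborel) \<le> ennreal (M powr p * r powr l))"
proof -
  have "ennreal ((1 / r powr l * (LINT y:ball x r|lebesgue. norm (f y) powr p)) powr (1 / p)) \<le> ennreal M
     \<longleftrightarrow> (\<integral>\<^sup>+y. ennreal (norm (f y) powr p) * indicator (ball x r) y \<partial>lborel) \<le> ennreal (M powr p * r powr l)"
    if r: "r > 0" for x r
  proof -
    define L where "L = (LINT y:ball x r|lebesgue. norm (f y) powr p)"
    have L: "L \<ge> 0" unfolding L_def set_lebesgue_integral_def by (intro integral_nonneg_AE) auto
    have rl: "r powr l > 0" using r by simp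
    have "(1 / r powr l * L) powr (1 / p) \<le> M \<longleftrightarrow> (1 / r powr l * L) \<le> M powr p"
    proof
      assume "(1 / r powr l * L) powr (1 / p) \<le> M"
      then have "((1 / r powr l * L) powr (1 / p)) powr p \<le> M powr p"
        using p by (intro powr_mono2) auto
      then show "1 / r powr l * L \<le> M powr p" using p L rl by (simp add: powr_powr)
    next
      assume "1 / r powr l * L \<le> M powr p"
      then have "(1 / r powr l * L) powr (1 / p) \<le> (M powr p) powr (1 / p)"
        using p L rl by (intro powr_mono2) auto
      then show "(1 / r powr l * L) powr (1 / p) \<le> M" using p M by (simp add: powr_powr)
    qed
    also have "\<dots> \<longleftrightarrow> L \<le> M powr p * r powr l" using rl by (simp add: field_simps)
    also have "\<dots> \<longleftrightarrow> (\<integral>\<^sup>+y. ennreal (norm (f y) powr p) * indicator (ball x r) y \<partial>lborel) \<le> ennreal (M powr p * r powr l)"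
      unfolding locally_p_integrable_ball[OF f, symmetric] L_def[symmetric] by simp
    finally show ?thesis using M unfolding L_def by simp
  qed
  then show ?thesis by (auto simp: morrey_norm_def SUP_le_iff)
qed

text \<open>Each coordinate agrees almost everywhere with a Borel function, and the finitely many
  exceptional sets together are null.\<close>

lemma borel_representative:
  fixes f :: "'a::euclidean_space \<Rightarrow> 'b::euclidean_space"
  assumes f: "f \<in> borel_measurable lebesgue"
  obtains f' where "f' \<in> borel_measurable borel" "AE x in lborel. f x = f' x"
proof -
  have "\<exists>h\<in>borel_measurable lborel. AE x in lborel. f x \<bullet> b = h x" for b
    using f by (intro completion_ex_borel_measurable_real) auto
  then have "\<forall>b. \<exists>h. h \<in> borel_measurable lborel \<and> (AE x in lborel. f x \<bullet> b = h x)" by blast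
  then obtain h where "\<forall>b. h b \<in> borel_measurable lborel \<and> (AE x in lborel. f x \<bullet> b = h b x)"
    by (rule choice[THEN exE])
  then have [measurable]: "\<And>b. h b \<in> borel_measurable borel"
    and h: "\<And>b. AE x in lborel. f x \<bullet> b = h b x" by auto
  show thesis
  proof (rule that)
    show "(\<lambda>x. \<Sum>b\<in>Basis. h b x *\<^sub>R b) \<in> borel_measurable borel" by measurable
    have "AE x in lborel. \<forall>b\<in>Basis. f x \<bullet> b = h b x"
      by (intro AE_finite_allI h) auto
    then show "AE x in lborel. f x = (\<Sum>b\<in>Basis. h b x *\<^sub>R b)"
    proof eventually_elim
      case (elim x)
      then show ?case using euclidean_representation[of "f x"] by simp
    qed
  qed
qed

section \<open>The operators\<close>

context sobolev_exponents
begin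

text \<open>\<open>g\<close> is the norm of a Borel representative of \<open>f\<close>: the
  potential, the Morrey integrals and the vanishing condition do not see null sets. The same
  \<open>g\<close> serves for all \<open>M\<close>.\<close>

lemma vanishing_morreyE:
  fixes f :: "'a::euclidean_space \<Rightarrow> 'b::euclidean_space"
  assumes f: "f \<in> vanishing_morrey_space p l"
  obtains g where "\<And>x. riesz_nn \<gamma> (\<lambda>y. ennreal (norm (f y))) x = riesz_nn \<gamma> (\<lambda>y. ennreal (g y)) x"
    "\<And>M. 0 \<le> M \<Longrightarrow> morrey_norm p l f \<le> ennreal M \<Longrightarrow> morrey_bound (M powr p) g"
    "(\<lambda>N::nat. SUP x. \<integral>\<^sup>+y. ennreal (g y powr p) * indicator (- ball 0 (real N)) y * indicator (ball x 1) y \<partial>lborel) \<longlonglongrightarrow> 0"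
proof -
  have loc: "locally_p_integrable p f"
    and van: "(\<lambda>N::nat. SUP x. \<integral>\<^sup>+ y\<in>ball x 1. ennreal (norm (f y) powr p * indicator (- ball 0 (real N)) y) \<partial>lebesgue) \<longlonglongrightarrow> 0"
    using f by (auto simp: vanishing_morrey_space_def morrey_space_def)
  then obtain f' where f' [measurable]: "f' \<in> borel_measurable borel" and ae: "AE x in lborel. f x = f' x"
    using borel_representative by (metis locally_p_integrable_def)
  show thesis
  proof (rule that)
    show "riesz_nn \<gamma> (\<lambda>y. ennreal (norm (f y))) x = riesz_nn \<gamma> (\<lambda>y. ennreal (norm (f' y))) x" for x
      unfolding riesz_nn_def using ae by (intro nn_integral_cong_AE) auto
    show "morrey_bound (M powr p) (\<lambda>y. norm (f' y))" if M: "0 \<le> M" "morrey_norm p l f \<le> ennreal M" for M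
      unfolding morrey_bound_def
    proof (intro conjI allI impI)
      fix x :: 'a and r :: real assume r: "r > 0"
      have "(\<integral>\<^sup>+y. ennreal (norm (f' y) powr p) * indicator (ball x r) y \<partial>lborel)
          = (\<integral>\<^sup>+y. ennreal (norm (f y) powr p) * indicator (ball x r) y \<partial>lborel)"
        using ae by (intro nn_integral_cong_AE) auto
      also have "\<dots> \<le> ennreal (M powr p * r powr l)"
        using M r p morrey_norm_le_iff[OF loc _ M(1)] by simp
      finally show "(\<integral>\<^sup>+y. ennreal (norm (f' y) powr p) * indicator (ball x r) y \<partial>lborel) \<le> ennreal (M powr p * r powr l)" .
    qed auto
    have "(\<integral>\<^sup>+ y\<in>ball x 1. ennreal (norm (f y) powr p * indicator (- ball 0 (real N)) y) \<partial>lebesgue)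
       = (\<integral>\<^sup>+y. ennreal (norm (f' y) powr p) * indicator (- ball 0 (real N)) y * indicator (ball x 1) y \<partial>lborel)" for x and N :: nat
      unfolding nn_integral_completion using ae
      by (intro nn_integral_cong_AE) (auto simp: indicator_def)
    then show "(\<lambda>N::nat. SUP x. \<integral>\<^sup>+y. ennreal (norm (f' y) powr p) * indicator (- ball 0 (real N)) y * indicator (ball x 1) y \<partial>lborel) \<longlonglongrightarrow> 0"
      using van by simp
  qed
qed

text \<open>Domination by the potential of the norm of \<open>f\<close> transfers the Morrey bound,
  the vanishing condition and finiteness almost everywhere. The origin is exempt in \<open>D\<close>
  because the powers of \<open>norm x\<close> in the Hardy operators vanish there, so a bound on the
  kernel integral says nothing about convergence.\<close>

lemma bounded_between_vanishing_morreyI: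
  fixes D :: "('a::euclidean_space \<Rightarrow> 'b::euclidean_space) \<Rightarrow> 'a \<Rightarrow> bool" and T :: "('a \<Rightarrow> 'b) \<Rightarrow> 'a \<Rightarrow> 'c::euclidean_space"
  assumes n: "n = real DIM('a)" and c: "c > 0"
    and D: "\<And>f x. f \<in> borel_measurable lebesgue \<Longrightarrow> riesz_nn (n - \<alpha>) (\<lambda>y. ennreal (norm (f y))) x < \<infinity> \<Longrightarrow> x \<noteq> 0 \<Longrightarrow> D f x"
    and T: "\<And>f. f \<in> borel_measurable lebesgue \<Longrightarrow> T f \<in> borel_measurable lebesgue"
    and dom: "\<And>f x. f \<in> borel_measurable lebesgue \<Longrightarrow>
       ennreal (norm (T f x)) \<le> ennreal c * riesz_nn (n - \<alpha>) (\<lambda>y. ennreal (norm (f y))) x"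
  shows "bounded_between_vanishing_morrey p q l D T"
proof -
  let ?J = "\<lambda>g x. ennpow (riesz_nn (n - \<alpha>) (\<lambda>y. ennreal (g y)) x) q"
  obtain C where C: "C > 0" and mor: "\<And>M r (g :: 'a \<Rightarrow> real) z. M > 0 \<Longrightarrow> r > 0 \<Longrightarrow> morrey_bound (M powr p) g \<Longrightarrow>
     (\<integral>\<^sup>+x. ?J g x * indicator (ball z r) x \<partial>lborel) \<le> ennreal (C * M powr q * r powr l)"
    using riesz_nn_morrey[OF n] by blast
  \<comment> \<open>Chosen so that \<open>C' powr q = c powr q * C\<close>.\<close>
  define C' where "C' = c * C powr (1 / q)"
  have C': "C' > 0" using c C by (simp add: C'_def)
  have main: "(AE x in lebesgue. D f x) \<and> T f \<in> vanishing_morrey_space q l \<and>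
      morrey_norm q l (T f) \<le> ennreal C' * morrey_norm p l f"
    if f: "f \<in> vanishing_morrey_space p l" for f
  proof -
    have fm: "f \<in> borel_measurable lebesgue" and fn: "morrey_norm p l f < \<infinity>"
      using f by (auto simp: vanishing_morrey_space_def morrey_space_def locally_p_integrable_def)
    obtain g where g: "\<And>x. riesz_nn (n - \<alpha>) (\<lambda>y. ennreal (norm (f y))) x = riesz_nn (n - \<alpha>) (\<lambda>y. ennreal (g y)) x"
      "\<And>M. 0 \<le> M \<Longrightarrow> morrey_norm p l f \<le> ennreal M \<Longrightarrow> morrey_bound (M powr p) g"
      "(\<lambda>N::nat. SUP x. \<integral>\<^sup>+y. ennreal (g y powr p) * indicator (- ball 0 (real N)) y * indicator (ball x 1) y \<partial>lborel) \<longlonglongrightarrow> 0"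
      using vanishing_morreyE[OF f] by blast
    obtain m where m: "m \<ge> 0" "morrey_norm p l f = ennreal m" using fn by (cases "morrey_norm p l f") auto
    \<comment> \<open>The norm \<open>m\<close> can be 0 while \<open>mor\<close> needs a positive
      bound, so everything is done for \<open>M > m\<close>.\<close>
    have bound: "(\<integral>\<^sup>+x. ?J g x * indicator (ball z r) x \<partial>lborel) \<le> ennreal (C * M powr q * r powr l)"
      if "M > m" "r > 0" for M r z
      using that m by (intro mor g(2)) auto
    have gb: "morrey_bound ((m + 1) powr p) g" using m by (intro g(2)) auto
    note [measurable] = morrey_boundD(1)[OF gb]
    have Tq: "ennreal (norm (T f x) powr q) \<le> ennreal (c powr q) * ?J g x" for x
      using dom[OF fm, of x] c q_pos unfolding g(1) by (intro ennpow_le_mult) auto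
    have Tbound: "(\<integral>\<^sup>+x. ennreal (norm (T f x) powr q) * indicator (ball z r) x \<partial>lborel) \<le> ennreal ((C' * M) powr q * r powr l)"
      if "M > m" "r > 0" for M r z
    proof -
      have "(\<integral>\<^sup>+x. ennreal (norm (T f x) powr q) * indicator (ball z r) x \<partial>lborel)
         \<le> (\<integral>\<^sup>+x. ennreal (c powr q) * (?J g x * indicator (ball z r) x) \<partial>lborel)"
        unfolding mult.assoc[symmetric] by (intro nn_integral_mono mult_right_mono Tq) auto
      also have "\<dots> = ennreal (c powr q) * (\<integral>\<^sup>+x. ?J g x * indicator (ball z r) x \<partial>lborel)"
        by (rule nn_integral_cmult) measurable
      also have "\<dots> \<le> ennreal (c powr q) * ennreal (C * M powr q * r powr l)"
        by (intro mult_left_mono bound that) auto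
      also have "\<dots> = ennreal ((C' * M) powr q * r powr l)"
        using c C q_pos m that by (simp add: C'_def powr_mult powr_powr mult_ac flip: ennreal_mult')
      finally show ?thesis .
    qed
    have loc: "locally_p_integrable q (T f)"
    proof (rule locally_p_integrableI[OF T[OF fm]])
      show "(\<integral>\<^sup>+y. ennreal (norm (T f y) powr q) * indicator (ball 0 r) y \<partial>lborel) < \<infinity>" if "r > 0" for r
        using Tbound[of "m + 1" r 0] that by (auto intro: order_le_less_trans)
    qed
    have norm_le: "morrey_norm q l (T f) \<le> ennreal (C' * M)" if "M > m" for M
      using Tbound that m C' q_pos by (subst morrey_norm_le_iff[OF loc]) auto
    \<comment> \<open>The bound at \<open>m\<close> itself follows by letting \<open>M\<close>
      decrease to \<open>m\<close>; the excess \<open>e / C'\<close> produces exactly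
      \<open>e\<close>.\<close>
    have "morrey_norm q l (T f) \<le> ennreal C' * morrey_norm p l f"
    proof (rule ennreal_le_epsilon)
      fix e :: real assume e: "e > 0"
      have "morrey_norm q l (T f) \<le> ennreal (C' * (m + e / C'))"
        by (rule norm_le) (use e C' in simp)
      also have "\<dots> = ennreal C' * morrey_norm p l f + ennreal e"
        using C' m e by (simp add: distrib_left ennreal_mult')
      finally show "morrey_norm q l (T f) \<le> ennreal C' * morrey_norm p l f + ennreal e" .
    qed
    moreover have "T f \<in> vanishing_morrey_space q l"
    proof -
      let ?W = "\<lambda>N::nat. SUP x. \<integral>\<^sup>+y. ?J g y * indicator (- ball 0 (real N)) y * indicator (ball x 1) y \<partial>lborel"
      have lim: "(\<lambda>N. ennreal (c powr q) * ?W N) \<longlonglongrightarrow> ennreal (c powr q) * 0"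
        using m by (intro ennreal_tendsto_cmult riesz_nn_vanishing[OF n _ gb g(3)]) auto
      have le: "(SUP x. \<integral>\<^sup>+ y\<in>ball x 1. ennreal (norm (T f y) powr q * indicator (- ball 0 (real N)) y) \<partial>lebesgue)
          \<le> ennreal (c powr q) * ?W N" for N :: nat
      proof (rule SUP_least)
        fix x :: 'a
        have "(\<integral>\<^sup>+ y\<in>ball x 1. ennreal (norm (T f y) powr q * indicator (- ball 0 (real N)) y) \<partial>lebesgue)
           \<le> (\<integral>\<^sup>+y. ennreal (c powr q) * (?J g y * indicator (- ball 0 (real N)) y * indicator (ball x 1) y) \<partial>lborel)"
          unfolding nn_integral_completion using Tq by (intro nn_integral_mono) (auto simp: indicator_def)
        also have "\<dots> = ennreal (c powr q) * (\<integral>\<^sup>+y. ?J g y * indicator (- ball 0 (real N)) y * indicator (ball x 1) y \<partial>lborel)"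
          by (rule nn_integral_cmult) measurable
        also have "\<dots> \<le> ennreal (c powr q) * ?W N"
          by (intro mult_left_mono SUP_upper) auto
        finally show "(\<integral>\<^sup>+ y\<in>ball x 1. ennreal (norm (T f y) powr q * indicator (- ball 0 (real N)) y) \<partial>lebesgue)
           \<le> ennreal (c powr q) * ?W N" .
      qed
      have "(\<lambda>N::nat. SUP x. \<integral>\<^sup>+ y\<in>ball x 1. ennreal (norm (T f y) powr q * indicator (- ball 0 (real N)) y) \<partial>lebesgue) \<longlonglongrightarrow> 0"
        by (rule tendsto_sandwich[OF _ _ tendsto_const lim[simplified mult_zero_right]]) (use le in auto)
      moreover have "morrey_norm q l (T f) < \<infinity>"
        using norm_le[of "m + 1"] by (auto intro: order_le_less_trans)
      ultimately show ?thesis using loc by (simp add: vanishing_morrey_space_def morrey_space_def)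
    qed
    moreover have "AE x in lebesgue. D f x"
    proof -
      \<comment> \<open>Finite integrals over countably many balls exhausting the space make the
        potential finite almost everywhere; \<open>Suc k\<close> keeps the radius positive.\<close>
      have "AE x in lborel. ?J g x * indicator (ball 0 (real (Suc k))) x \<noteq> \<infinity>" for k
      proof (rule nn_integral_PInf_AE)
        show "(\<integral>\<^sup>+x. ?J g x * indicator (ball 0 (real (Suc k))) x \<partial>lborel) \<noteq> \<infinity>"
          using bound[of "m + 1" "real (Suc k)" 0] by (auto simp: top_unique)
      qed measurable
      then have "AE x in lborel. \<forall>k. ?J g x * indicator (ball 0 (real (Suc k))) x \<noteq> \<infinity>"
        by (simp add: AE_all_countable)
      moreover have "AE x in lborel. x \<noteq> (0::'a)" by (rule AE_lborel_singleton)
      ultimately have "AE x in lborel. D f x"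
      proof eventually_elim
        case (elim x)
        obtain k :: nat where "norm x < real k" using reals_Archimedean2 by blast
        then have "x \<in> ball 0 (real (Suc k))" by simp
        then have "?J g x \<noteq> top" using elim(1)[rule_format, of k] by simp
        then have "riesz_nn (n - \<alpha>) (\<lambda>y. ennreal (norm (f y))) x < \<infinity>"
          unfolding g(1) by (cases "riesz_nn (n - \<alpha>) (\<lambda>y. ennreal (g y)) x") auto
        then show ?case using D[OF fm] elim(2) by blast
      qed
      then show ?thesis by (rule AE_completion)
    qed
    ultimately show ?thesis by blast
  qed
  then show ?thesis unfolding bounded_between_vanishing_morrey_def by blast
qed

text \<open>This serves the three operators given by a kernel. Domination by the Riesz kernel yields
  absolute convergence and the pointwise bound; measurability of \<open>T f\<close> comes from a
  Borel representative.\<close>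

lemma kernel_operator_bounded:
  fixes D :: "('a::euclidean_space \<Rightarrow> 'b::euclidean_space) \<Rightarrow> 'a \<Rightarrow> bool" and T :: "('a \<Rightarrow> 'b) \<Rightarrow> 'a \<Rightarrow> 'b"
  assumes n: "n = real DIM('a)" and c: "c > 0"
    and k [measurable]: "case_prod k \<in> borel_measurable (borel \<Otimes>\<^sub>M borel)"
    and k_le: "\<And>x y. 0 \<le> k x y" "\<And>x y. k x y \<le> c / norm (x - y) powr (n - \<alpha>)"
    and D: "\<And>f x. integrable lebesgue (\<lambda>y. k x y *\<^sub>R f y) \<Longrightarrow> x \<noteq> 0 \<Longrightarrow> D f x"
    and T: "\<And>f x. T f x = (LINT y|lebesgue. k x y *\<^sub>R f y)"
  shows "bounded_between_vanishing_morrey p q l D T"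
proof (rule bounded_between_vanishing_morreyI[OF n c])
  fix f :: "'a \<Rightarrow> 'b"
  assume f [measurable]: "f \<in> borel_measurable lebesgue"
  have kx [measurable]: "k x \<in> borel_measurable borel" for x
  proof -
    have "(\<lambda>y. case_prod k (x, y)) \<in> borel_measurable borel" by measurable
    then show ?thesis by simp
  qed
  have kl [measurable]: "k x \<in> borel_measurable lebesgue" for x
    by (rule measurable_completion) (simp add: kx)
  have dom: "(\<integral>\<^sup>+y. ennreal (norm (k x y *\<^sub>R f y)) \<partial>lebesgue) \<le> ennreal c * riesz_nn (n - \<alpha>) (\<lambda>y. ennreal (norm (f y))) x" for x
  proof -
    have "(\<integral>\<^sup>+y. ennreal (norm (k x y *\<^sub>R f y)) \<partial>lebesgue)
      \<le> (\<integral>\<^sup>+y. ennreal c * (ennreal (1 / norm (x - y) powr (n - \<alpha>)) * ennreal (norm (f y))) \<partial>lebesgue)"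
    proof (rule nn_integral_mono)
      fix y
      have "norm (k x y *\<^sub>R f y) \<le> c * (1 / norm (x - y) powr (n - \<alpha>) * norm (f y))"
        using mult_right_mono[OF k_le(2)[of x y], of "norm (f y)"] k_le(1)[of x y] by simp
      then show "ennreal (norm (k x y *\<^sub>R f y)) \<le> ennreal c * (ennreal (1 / norm (x - y) powr (n - \<alpha>)) * ennreal (norm (f y)))"
        using c by (simp flip: ennreal_mult' add: ennreal_leI)
    qed
    also have "\<dots> = ennreal c * (\<integral>\<^sup>+y. ennreal (1 / norm (x - y) powr (n - \<alpha>)) * ennreal (norm (f y)) \<partial>lebesgue)"
    proof (rule nn_integral_cmult)
      have [measurable]: "(\<lambda>y. ennreal (1 / norm (x - y) powr (n - \<alpha>))) \<in> borel_measurable lebesgue"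
        by (rule measurable_completion) measurable
      show "(\<lambda>y. ennreal (1 / norm (x - y) powr (n - \<alpha>)) * ennreal (norm (f y))) \<in> borel_measurable lebesgue"
        by measurable
    qed
    finally show ?thesis by (simp add: riesz_nn_def nn_integral_completion)
  qed
  show "ennreal (norm (T f x)) \<le> ennreal c * riesz_nn (n - \<alpha>) (\<lambda>y. ennreal (norm (f y))) x" for x
  proof (cases "integrable lebesgue (\<lambda>y. k x y *\<^sub>R f y)")
    case True
    show ?thesis unfolding T by (rule order_trans[OF integral_norm_bound_ennreal[OF True] dom])
  next
    \<comment> \<open>Where the integral diverges, \<open>T f x\<close> has the default value
      0.\<close>
    case False
    then show ?thesis unfolding T by (simp add: not_integrable_integral_eq)
  qed
  show "D f x" if "riesz_nn (n - \<alpha>) (\<lambda>y. ennreal (norm (f y))) x < \<infinity>" "x \<noteq> 0" for x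
  proof (rule D[OF integrableI_bounded that(2)])
    show "(\<integral>\<^sup>+y. ennreal (norm (k x y *\<^sub>R f y)) \<partial>lebesgue) < \<infinity>"
      using order_le_less_trans[OF dom[of x]] that(1) by (simp add: ennreal_mult_less_top)
  qed measurable
  \<comment> \<open>Replacing \<open>f\<close> by a Borel function changes the integral at no
    \<open>x\<close>, and for that function the integrand is measurable in the pair.\<close>
  obtain f' where f' [measurable]: "f' \<in> borel_measurable borel" and ae: "AE x in lborel. f x = f' x"
    using borel_representative[OF f] .
  have f'l [measurable]: "f' \<in> borel_measurable lebesgue" by (rule measurable_completion) simp
  have "T f = (\<lambda>x. LINT y|lborel. k x y *\<^sub>R f' y)"
  proof
    fix x
    have "(LINT y|lebesgue. k x y *\<^sub>R f y) = (LINT y|lebesgue. k x y *\<^sub>R f' y)"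
    proof (rule integral_cong_AE)
      show "AE y in lebesgue. k x y *\<^sub>R f y = k x y *\<^sub>R f' y"
        using AE_completion[OF ae] by auto
    qed measurable
    also have "\<dots> = (LINT y|lborel. k x y *\<^sub>R f' y)"
      by (rule integral_completion) measurable
    finally show "T f x = (LINT y|lborel. k x y *\<^sub>R f' y)" unfolding T .
  qed
  also have "\<dots> \<in> borel_measurable lborel"
    by (rule lborel.borel_measurable_lebesgue_integral) (simp add: split_def; measurable)
  finally show "T f \<in> borel_measurable lebesgue" by (rule measurable_completion)
qed

end

text \<open>If the quantity for \<open>ball x t\<close> exceeds \<open>u\<close>, it still does with
  the normalising factor of a slightly larger radius \<open>s\<close> and the same integral. Any
  \<open>y\<close> within \<open>s - t\<close> of \<open>x\<close> satisfies
  \<open>ball x t \<subseteq> ball y s\<close>, so the supremum at \<open>y\<close> exceeds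
  \<open>u\<close> as well.\<close>

lemma open_less_ext_fractional_maximal:
  fixes f :: "'a::euclidean_space \<Rightarrow> 'b::euclidean_space"
  shows "open {x. u < ext_fractional_maximal \<alpha> f x}"
proof (rule openI)
  let ?\<phi> = "\<lambda>t. 1 / (unit_ball_vol (real DIM('a)) * t ^ DIM('a)) powr (1 - \<alpha> / real DIM('a))"
  let ?I = "\<lambda>x t. \<integral>\<^sup>+ y\<in>ball x t. ennreal (norm (f y)) \<partial>lebesgue"
  have ext: "ext_fractional_maximal \<alpha> f x = (SUP t\<in>{0<..}. ennreal (?\<phi> t) * ?I x t)" for x
    unfolding ext_fractional_maximal_def by (intro SUP_cong) (auto simp: content_ball)
  fix x assume "x \<in> {x. u < ext_fractional_maximal \<alpha> f x}"
  then obtain t where t: "t > 0" "u < ennreal (?\<phi> t) * ?I x t"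
    by (auto simp: ext less_SUP_iff)
  have pos: "unit_ball_vol (real DIM('a)) * t ^ DIM('a) > 0" using t by simp
  \<comment> \<open>Only the factor varies with \<open>s\<close>. The integral may be infinite, yet
    the product converges since the limit of the factor is finite and nonzero.\<close>
  with t have "((\<lambda>s. ennreal (?\<phi> s) * ?I x t) \<longlongrightarrow> ennreal (?\<phi> t) * ?I x t) (at_right t)"
    by (intro tendsto_mult_ennreal tendsto_ennrealI tendsto_intros) (auto simp: ennreal_eq_0_iff)
  then have "eventually (\<lambda>s. u < ennreal (?\<phi> s) * ?I x t) (at_right t)"
    using t(2) by (rule order_tendstoD)
  then have "eventually (\<lambda>s. u < ennreal (?\<phi> s) * ?I x t \<and> t < s) (at_right t)"
    by (rule eventually_conj) (rule eventually_at_right_less)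
  then obtain s where s: "u < ennreal (?\<phi> s) * ?I x t" "t < s"
    using eventually_happens' trivial_limit_at_right_real by blast
  have "ball x (s - t) \<subseteq> {x. u < ext_fractional_maximal \<alpha> f x}"
  proof
    fix y assume y: "y \<in> ball x (s - t)"
    have "z \<in> ball y s" if "z \<in> ball x t" for z
      using y that dist_triangle[of y z x] by (simp add: dist_commute)
    then have "?I x t \<le> ?I y s"
      by (intro nn_integral_mono) (auto simp: indicator_def)
    then have "u < ennreal (?\<phi> s) * ?I y s"
      using s(1) by (meson mult_left_mono order_less_le_trans zero_le)
    also have "\<dots> \<le> ext_fractional_maximal \<alpha> f y"
      unfolding ext using s t by (intro SUP_upper) auto
    finally show "y \<in> {x. u < ext_fractional_maximal \<alpha> f x}" by simp
  qed
  then show "\<exists>e>0. ball x e \<subseteq> {x. u < ext_fractional_maximal \<alpha> f x}" using s by (intro exI[of _ "s - t"]) auto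
qed

lemma borel_measurable_ext_fractional_maximal [measurable]:
  "ext_fractional_maximal \<alpha> f \<in> borel_measurable borel"
  by (rule borel_measurableI_greater) (simp add: open_less_ext_fractional_maximal)

text \<open>On \<open>ball x t\<close> the Riesz kernel is at least
  \<open>1 / t powr (n - \<alpha>)\<close>, which up to the unit ball constant is the normalising
  factor of the maximal operator.\<close>

lemma ext_fractional_maximal_le_riesz_nn:
  fixes f :: "'a::euclidean_space \<Rightarrow> 'b::euclidean_space"
  assumes "\<alpha> < real DIM('a)" and f [measurable]: "f \<in> borel_measurable lebesgue"
  shows "ext_fractional_maximal \<alpha> f x \<le> ennreal (1 / unit_ball_vol (real DIM('a)) powr (1 - \<alpha> / real DIM('a)))
     * riesz_nn (real DIM('a) - \<alpha>) (\<lambda>y. ennreal (norm (f y))) x"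
  unfolding ext_fractional_maximal_def
proof (rule SUP_least)
  let ?n = "real DIM('a)" and ?w = "unit_ball_vol (real DIM('a)) powr (1 - \<alpha> / real DIM('a))"
  fix t :: real assume "t \<in> {0<..}"
  then have t: "t > 0" by simp
  have "unit_ball_vol ?n > 0" by simp
  then have w: "?w > 0" unfolding powr_gt_zero by (rule less_imp_neq[THEN not_sym])
  have vol: "measure lebesgue (ball x t) powr (1 - \<alpha> / ?n) = ?w * t powr (?n - \<alpha>)"
  proof -
    have "(t powr ?n) powr (1 - \<alpha> / ?n) = t powr (?n - \<alpha>)"
      by (simp add: powr_powr right_diff_distrib)
    then show ?thesis using t by (simp add: content_ball powr_mult powr_realpow)
  qed
  have [measurable]: "(\<lambda>y. indicator (ball x t) y :: ennreal) \<in> borel_measurable lebesgue"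
    by (rule measurable_completion) measurable
  have "ennreal (1 / measure lebesgue (ball x t) powr (1 - \<alpha> / ?n)) * (\<integral>\<^sup>+ y\<in>ball x t. ennreal (norm (f y)) \<partial>lebesgue)
     = ennreal (1 / ?w) * (ennreal (1 / t powr (?n - \<alpha>)) * (\<integral>\<^sup>+ y\<in>ball x t. ennreal (norm (f y)) \<partial>lebesgue))"
    unfolding vol using w by (simp flip: ennreal_mult' add: mult.assoc[symmetric])
  also have "ennreal (1 / t powr (?n - \<alpha>)) * (\<integral>\<^sup>+ y\<in>ball x t. ennreal (norm (f y)) \<partial>lebesgue)
    = (\<integral>\<^sup>+ y. ennreal (1 / t powr (?n - \<alpha>)) * (ennreal (norm (f y)) * indicator (ball x t) y) \<partial>lebesgue)"
    by (rule nn_integral_cmult[symmetric]) measurable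
  also have "\<dots> \<le> riesz_nn (?n - \<alpha>) (\<lambda>y. ennreal (norm (f y))) x"
    unfolding riesz_nn_def nn_integral_completion
  proof (rule nn_integral_mono_AE)
    \<comment> \<open>The centre \<open>y = x\<close> must be left out, since the kernel has value 0
      there.\<close>
    show "AE y in lborel. ennreal (1 / t powr (?n - \<alpha>)) * (ennreal (norm (f y)) * indicator (ball x t) y)
        \<le> ennreal (1 / norm (x - y) powr (?n - \<alpha>)) * ennreal (norm (f y))"
      using AE_lborel_singleton[of x]
    proof eventually_elim
      case (elim y)
      show ?case
      proof (cases "y \<in> ball x t")
        case True
        then have "norm (x - y) powr (?n - \<alpha>) \<le> t powr (?n - \<alpha>)"
          using assms by (intro powr_mono2) (auto simp: dist_norm)
        then have "1 / t powr (?n - \<alpha>) \<le> 1 / norm (x - y) powr (?n - \<alpha>)"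
          using elim t by (intro divide_left_mono mult_pos_pos) auto
        then show ?thesis using True by (auto intro!: mult_right_mono ennreal_leI)
      qed simp
    qed
  qed
  finally show "ennreal (1 / measure lebesgue (ball x t) powr (1 - \<alpha> / ?n)) * (\<integral>\<^sup>+ y\<in>ball x t. ennreal (norm (f y)) \<partial>lebesgue)
     \<le> ennreal (1 / ?w) * riesz_nn (?n - \<alpha>) (\<lambda>y. ennreal (norm (f y))) x"
    by (simp add: mult_left_mono)
qed

section \<open>Verification for the four operators\<close>

context sobolev_exponents
begin

lemma riesz_potential_bounded:
  assumes n: "n = real DIM('a::euclidean_space)"
  shows "bounded_between_vanishing_morrey p q l (riesz_potential_defined \<alpha>)
    (riesz_potential \<alpha> :: ('a \<Rightarrow> 'b::euclidean_space) \<Rightarrow> 'a \<Rightarrow> 'b)"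
proof (rule kernel_operator_bounded[OF n, of 1])
  show "(\<lambda>(x, y). 1 / norm (x - y) powr (n - \<alpha>)) \<in> borel_measurable (borel \<Otimes>\<^sub>M (borel :: 'a measure))"
    by measurable
qed (auto simp: riesz_potential_defined_def riesz_potential_def n)

text \<open>The operator is not given by a kernel, so the domination criterion is used directly;
  measurability comes from lower semicontinuity.\<close>

lemma fractional_maximal_bounded:
  assumes n: "n = real DIM('a::euclidean_space)"
  shows "bounded_between_vanishing_morrey p q l (fractional_maximal_defined \<alpha>)
    (fractional_maximal \<alpha> :: ('a \<Rightarrow> 'b::euclidean_space) \<Rightarrow> 'a \<Rightarrow> real)"
proof (rule bounded_between_vanishing_morreyI[OF n])
  have "unit_ball_vol n > 0" using \<alpha> by simp
  then show "1 / unit_ball_vol n powr (1 - \<alpha> / n) > 0" by simp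
  fix f :: "'a \<Rightarrow> 'b" and x
  assume f: "f \<in> borel_measurable lebesgue"
  note le = ext_fractional_maximal_le_riesz_nn[OF \<alpha>(2)[unfolded n] f, folded n]
  show "fractional_maximal_defined \<alpha> f x" if "riesz_nn (n - \<alpha>) (\<lambda>y. ennreal (norm (f y))) x < \<infinity>"
    unfolding fractional_maximal_defined_def
    using order_le_less_trans[OF le] that by (simp add: ennreal_mult_less_top)
  show "fractional_maximal \<alpha> f \<in> borel_measurable lebesgue"
    unfolding fractional_maximal_def[abs_def] by (rule measurable_completion) measurable
  \<comment> \<open>Passing to real values turns an infinite supremum into 0 and otherwise changes
    nothing.\<close>
  have "ennreal (norm (fractional_maximal \<alpha> f x)) \<le> ext_fractional_maximal \<alpha> f x"
    unfolding fractional_maximal_def by (cases "ext_fractional_maximal \<alpha> f x") auto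
  then show "ennreal (norm (fractional_maximal \<alpha> f x)) \<le> ennreal (1 / unit_ball_vol n powr (1 - \<alpha> / n))
     * riesz_nn (n - \<alpha>) (\<lambda>y. ennreal (norm (f y))) x"
    by (rule order_trans) (rule le)
qed

text \<open>The distance of the two points is at most \<open>2 * R\<close>. Taking \<open>R\<close>
  as the larger of the two norms compares both Hardy kernels with the Riesz kernel.\<close>

lemma powr_le_riesz_kernel:
  fixes x y :: "'a::real_normed_vector"
  assumes "norm x \<le> R" "norm y \<le> R" "x \<noteq> y"
  shows "R powr (\<alpha> - n) \<le> 2 powr (n - \<alpha>) / norm (x - y) powr (n - \<alpha>)"
proof -
  have le: "norm (x - y) \<le> 2 * R" using norm_triangle_ineq4[of x y] assms by simp
  have d: "norm (x - y) > 0" using assms by simp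
  have R: "R > 0" using le d by linarith
  have "norm (x - y) powr (n - \<alpha>) \<le> (2 * R) powr (n - \<alpha>)"
    using \<alpha> le by (intro powr_mono2) auto
  also have "\<dots> = 2 powr (n - \<alpha>) * R powr (n - \<alpha>)" using R by (simp add: powr_mult)
  finally have "norm (x - y) powr (n - \<alpha>) \<le> 2 powr (n - \<alpha>) * R powr (n - \<alpha>)" .
  then have "1 / R powr (n - \<alpha>) \<le> 2 powr (n - \<alpha>) / norm (x - y) powr (n - \<alpha>)"
    using R d by (simp add: field_simps)
  then show ?thesis using powr_minus_divide[of R "n - \<alpha>"] by simp
qed

lemma hardy_inner_bounded:
  assumes n: "n = real DIM('a::euclidean_space)"
  shows "bounded_between_vanishing_morrey p q l (hardy_inner_defined \<alpha>)
    (hardy_inner \<alpha> :: ('a \<Rightarrow> 'b::euclidean_space) \<Rightarrow> 'a \<Rightarrow> 'b)"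
proof (rule kernel_operator_bounded[OF n, of "2 powr (n - \<alpha>)"])
  let ?k = "\<lambda>x y :: 'a. norm x powr (\<alpha> - n) * indicator {y. norm y < norm x} y"
  \<comment> \<open>The indicator of a set that varies with \<open>x\<close> is treated as a
    condition on the pair, for which joint measurability is clear.\<close>
  have "(\<lambda>(x, y). norm x powr (\<alpha> - n) * (if norm y < norm x then 1 else 0)) \<in> borel_measurable (borel \<Otimes>\<^sub>M (borel :: 'a measure))"
    by measurable
  then show "case_prod ?k \<in> borel_measurable (borel \<Otimes>\<^sub>M borel)"
    by (simp add: indicator_def of_bool_def)
  \<comment> \<open>On the diagonal the right side is a division by 0, hence 0; the strict
    inequality in the indicator makes the left side vanish too.\<close>
  show "?k x y \<le> 2 powr (n - \<alpha>) / norm (x - y) powr (n - \<alpha>)" for x y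
    using powr_le_riesz_kernel[of x "norm x" y] by (cases "x = y") (auto simp: indicator_def)
  show "hardy_inner_defined \<alpha> f x" if "integrable lebesgue (\<lambda>y. ?k x y *\<^sub>R f y)" "x \<noteq> 0" for f :: "'a \<Rightarrow> 'b" and x
  proof -
    \<comment> \<open>Away from the origin the power of \<open>norm x\<close> is nonzero and can be
      divided out.\<close>
    have "integrable lebesgue (\<lambda>y. inverse (norm x powr (\<alpha> - n)) *\<^sub>R (?k x y *\<^sub>R f y))"
      using that(1) by (rule integrable_scaleR_right)
    then show ?thesis
      using that(2) by (simp add: hardy_inner_defined_def set_integrable_def mult.assoc[symmetric])
  qed
  show "hardy_inner \<alpha> f x = (LINT y|lebesgue. ?k x y *\<^sub>R f y)" for f :: "'a \<Rightarrow> 'b" and x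
    by (simp add: hardy_inner_def set_lebesgue_integral_def n flip: integral_scaleR_right)
qed auto

lemma hardy_outer_bounded:
  assumes n: "n = real DIM('a::euclidean_space)"
  shows "bounded_between_vanishing_morrey p q l (hardy_outer_defined \<alpha>)
    (hardy_outer \<alpha> :: ('a \<Rightarrow> 'b::euclidean_space) \<Rightarrow> 'a \<Rightarrow> 'b)"
proof (rule kernel_operator_bounded[OF n, of "2 powr (n - \<alpha>)"])
  let ?k = "\<lambda>x y :: 'a. norm x powr \<alpha> * (indicator {y. norm y > norm x} y * (1 / norm y ^ DIM('a)))"
  have "(\<lambda>(x, y). norm x powr \<alpha> * ((if norm x < norm y then 1 else 0) * (1 / norm y ^ DIM('a)))) \<in> borel_measurable (borel \<Otimes>\<^sub>M (borel :: 'a measure))"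
    by measurable
  then show "case_prod ?k \<in> borel_measurable (borel \<Otimes>\<^sub>M borel)"
    by (simp add: indicator_def of_bool_def)
  show "?k x y \<le> 2 powr (n - \<alpha>) / norm (x - y) powr (n - \<alpha>)" for x y
  proof (cases "norm x < norm y")
    case True
    then have y: "norm y > 0" by (smt (verit) norm_ge_zero)
    \<comment> \<open>Enlarging \<open>norm x\<close> to \<open>norm y\<close> reduces the kernel to
      \<open>norm y powr (\<alpha> - n)\<close>, the case \<open>R = norm y\<close> of the
      comparison.\<close>
    have "norm x powr \<alpha> \<le> norm y powr \<alpha>" using True \<alpha> by (intro powr_mono2) auto
    then have "?k x y \<le> norm y powr \<alpha> / norm y ^ DIM('a)" using True by (simp add: divide_right_mono)
    also have "\<dots> = norm y powr (\<alpha> - n)" using y by (simp add: powr_diff powr_realpow n)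
    also have "\<dots> \<le> 2 powr (n - \<alpha>) / norm (x - y) powr (n - \<alpha>)"
      using True by (intro powr_le_riesz_kernel) auto
    finally show ?thesis .
  qed simp
  show "hardy_outer_defined \<alpha> f x" if "integrable lebesgue (\<lambda>y. ?k x y *\<^sub>R f y)" "x \<noteq> 0" for f :: "'a \<Rightarrow> 'b" and x
  proof -
    have "integrable lebesgue (\<lambda>y. inverse (norm x powr \<alpha>) *\<^sub>R (?k x y *\<^sub>R f y))"
      using that(1) by (rule integrable_scaleR_right)
    then show ?thesis
      using that(2) by (simp add: hardy_outer_defined_def set_integrable_def mult.assoc[symmetric])
  qed
  show "hardy_outer \<alpha> f x = (LINT y|lebesgue. ?k x y *\<^sub>R f y)" for f :: "'a \<Rightarrow> 'b" and x
    by (simp add: hardy_outer_def set_lebesgue_integral_def flip: integral_scaleR_right)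
qed auto

end

theorem theorem3p8:
  fixes \<alpha> l p q :: real
  assumes "0 < \<alpha>" and "\<alpha> < real DIM('a::euclidean_space)"
    and "0 \<le> l" and "l < real DIM('a)"
    and "1 < p" and "p < (real DIM('a) - l) / \<alpha>"
    and "1 / q = 1 / p - \<alpha> / (real DIM('a) - l)"
  shows "bounded_between_vanishing_morrey p q l (riesz_potential_defined \<alpha>)
           (riesz_potential \<alpha> :: ('a \<Rightarrow> 'b::{real_normed_field,euclidean_space}) \<Rightarrow> 'a \<Rightarrow> 'b)
    \<and> bounded_between_vanishing_morrey p q l (fractional_maximal_defined \<alpha>)
           (fractional_maximal \<alpha> :: ('a \<Rightarrow> 'b) \<Rightarrow> 'a \<Rightarrow> real)
    \<and> bounded_between_vanishing_morrey p q l (hardy_inner_defined \<alpha>)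
           (hardy_inner \<alpha> :: ('a \<Rightarrow> 'b) \<Rightarrow> 'a \<Rightarrow> 'b)
    \<and> bounded_between_vanishing_morrey p q l (hardy_outer_defined \<alpha>)
           (hardy_outer \<alpha> :: ('a \<Rightarrow> 'b) \<Rightarrow> 'a \<Rightarrow> 'b)"
proof -
  interpret sobolev_exponents \<alpha> l p q "real DIM('a)"
    by standard (use assms in auto)
  show ?thesis
    by (intro conjI riesz_potential_bounded fractional_maximal_bounded hardy_inner_bounded hardy_outer_bounded refl)
qed

end
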